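(* Let $R$ be a ring and let $J$ be a complete ideal filter on $R$. Let $T$ be a $J$-injective and $J$-torsion left $R$-module and let $M$ be any left $R$-module. Assume that $T$ is a cogenerator for every quotient of $M$ and that $\operatorname{Hom}_R(M,T)$ is Noetherian as an $\operatorname{End}_R(T)$-module. Then the maps $$M'\mapsto \operatorname{Hom}_R(M/M',T),\qquad V\mapsto\ker(V)$$ define an inclusion-reversing bijection (and are inverse to each other) between the set of $R$-submodules $M'$ of $M$ and the set of $\operatorname{End}_R(T)$-submodules $V$ of $\operatorname{Hom}_R(M,T)$.
   Context: Rings are unitary, not necessarily commutative; modules are left modules. An ideal filter of $R$ is a non-empty set $J$ of right ideals of $R$ closed under pairwise intersection and such that any right ideal containing an element of $J$ is in $J$. For left $R$-modules $A\subseteq B$, $(A:_BJ):=\{x\in B\mid Ix\subseteq A\text{ for some }I\in J\}$, a submodule of $B$; $B[J]:=(0:_BJ)$, and $B$ is $J$-torsion if $B=B[J]$. $J$ is complete if $((A:_BJ):_BJ)=(A:_BJ)$ for all left $R$-modules $A\subseteq B$. A $J$-extension is an injective $R$-homomorphism $i:A\hookrightarrow B$ with $(i(A):_BJ)=B$. A left $R$-module $Q$ is $J$-injective if for every $J$-extension $i:A\hookrightarrow B$ and every $R$-homomorphism $f:A\to Q$ there is an $R$-homomorphism $g:B\to Q$ with $g\circ i=f$. For a subset $V\subseteq\operatorname{Hom}_R(M,T)$, $\ker(V):=\bigcap_{f\in V}\ker(f)\subseteq M$. For a submodule $M'\subseteq M$, $\operatorname{Hom}_R(M/M',T)$ is identified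 with $\{f\in\operatorname{Hom}_R(M,T)\mid\ker(f)\supseteq M'\}$. A module $Q$ is a cogenerator for $N$ if $\ker(\operatorname{Hom}_R(N,Q))=0$. $\operatorname{Hom}_R(M,T)$ is a left $\operatorname{End}_R(T)$-module by composition. *)

theory Defs
  imports "HOL-Algebra.Module" "HOL-Algebra.AbelCoset"
begin

section \<open>Left modules over a not necessarily commutative ring\<close>

text \<open>
  The locale \<open>module\<close> of HOL-Algebra requires a commutative base ring. The record type \<open>module\<close> and the
  locale \<open>submodule\<close> do not, and are reused here; the fields \<open>mult\<close> and \<open>one\<close> that
  the record type \<open>module\<close> inherits from rings carry no information.
\<close>

locale left_module = R?: ring + M?: abelian_group M for M (structure) +
  assumes smult_closed [simp, intro]:
      "\<lbrakk>a \<in> carrier R; x \<in> carrier M\<rbrakk> \<Longrightarrow> a \<odot>\<^bsub>M\<^esub> x \<in> carrier M"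
    and smult_l_distr:
      "\<lbrakk>a \<in> carrier R; b \<in> carrier R; x \<in> carrier M\<rbrakk> \<Longrightarrow>
       (a \<oplus> b) \<odot>\<^bsub>M\<^esub> x = a \<odot>\<^bsub>M\<^esub> x \<oplus>\<^bsub>M\<^esub> b \<odot>\<^bsub>M\<^esub> x"
    and smult_r_distr:
      "\<lbrakk>a \<in> carrier R; x \<in> carrier M; y \<in> carrier M\<rbrakk> \<Longrightarrow>
       a \<odot>\<^bsub>M\<^esub> (x \<oplus>\<^bsub>M\<^esub> y) = a \<odot>\<^bsub>M\<^esub> x \<oplus>\<^bsub>M\<^esub> a \<odot>\<^bsub>M\<^esub> y"
    and smult_assoc1:
      "\<lbrakk>a \<in> carrier R; b \<in> carrier R; x \<in> carrier M\<rbrakk> \<Longrightarrow>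
       (a \<otimes> b) \<odot>\<^bsub>M\<^esub> x = a \<odot>\<^bsub>M\<^esub> (b \<odot>\<^bsub>M\<^esub> x)"
    and smult_one [simp]:
      "x \<in> carrier M \<Longrightarrow> \<one> \<odot>\<^bsub>M\<^esub> x = x"

text \<open>
  Homomorphisms are extensional on the carrier of their domain, so that equality of functions
  is equality of homomorphisms.
\<close>

definition lmod_hom ::
    "('r, 'x) ring_scheme \<Rightarrow> ('r, 'a) module \<Rightarrow> ('r, 'b) module \<Rightarrow> ('a \<Rightarrow> 'b) set" where
  "lmod_hom R M N =
     {f \<in> carrier M \<rightarrow>\<^sub>E carrier N.
        (\<forall>x\<in>carrier M. \<forall>y\<in>carrier M. f (x \<oplus>\<^bsub>M\<^esub> y) = f x \<oplus>\<^bsub>N\<^esub> f y) \<and>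
        (\<forall>a\<in>carrier R. \<forall>x\<in>carrier M. f (a \<odot>\<^bsub>M\<^esub> x) = a \<odot>\<^bsub>N\<^esub> f x)}"

definition quot_module :: "('r, 'a) module \<Rightarrow> 'a set \<Rightarrow> ('r, 'a set) module" where
  "quot_module M N =
     \<lparr>carrier = a_rcosets\<^bsub>M\<^esub> N, mult = undefined, one = undefined,
      zero = N, add = set_add M,
      smult = \<lambda>a X. \<Union>x\<in>X. N +>\<^bsub>M\<^esub> (a \<odot>\<^bsub>M\<^esub> x)\<rparr>"

definition End_ring :: "('r, 'x) ring_scheme \<Rightarrow> ('r, 'a) module \<Rightarrow> ('a \<Rightarrow> 'a) ring" where
  "End_ring R T =
     \<lparr>carrier = lmod_hom R T T,
      mult = \<lambda>e f. compose (carrier T) e f,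
      one = \<lambda>x\<in>carrier T. x,
      zero = \<lambda>x\<in>carrier T. \<zero>\<^bsub>T\<^esub>,
      add = \<lambda>e f. \<lambda>x\<in>carrier T. e x \<oplus>\<^bsub>T\<^esub> f x\<rparr>"

text \<open>\<open>Hom\<^sub>R(M, T)\<close> as a left module over \<open>End\<^sub>R(T)\<close>, acting by composition.\<close>

definition Hom_module ::
    "('r, 'x) ring_scheme \<Rightarrow> ('r, 'm) module \<Rightarrow> ('r, 't) module \<Rightarrow> ('t \<Rightarrow> 't, 'm \<Rightarrow> 't) module" where
  "Hom_module R M T =
     \<lparr>carrier = lmod_hom R M T, mult = undefined, one = undefined,
      zero = \<lambda>x\<in>carrier M. \<zero>\<^bsub>T\<^esub>,
      add = \<lambda>f g. \<lambda>x\<in>carrier M. f x \<oplus>\<^bsub>T\<^esub> g x,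
      smult = \<lambda>e f. compose (carrier M) e f\<rparr>"

definition noetherian_module :: "('r, 'x) ring_scheme \<Rightarrow> ('r, 'a) module \<Rightarrow> bool" where
  "noetherian_module R M \<longleftrightarrow>
     (\<forall>N :: nat \<Rightarrow> 'a set.
        (\<forall>n. submodule (N n) R M) \<and> (\<forall>n. N n \<subseteq> N (Suc n)) \<longrightarrow> (\<exists>n. \<forall>m\<ge>n. N m = N n))"

definition hom_ker :: "('r, 'm) module \<Rightarrow> ('r, 't) module \<Rightarrow> ('m \<Rightarrow> 't) set \<Rightarrow> 'm set" where
  "hom_ker M T V = carrier M \<inter> (\<Inter>f\<in>V. a_kernel M T f)"

text \<open>\<open>Hom\<^sub>R(M/M', T)\<close>, identified with a set of homomorphisms on \<open>M\<close>; see
  \<open>bij_betw_quot_hom\<close> below.\<close>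

definition quot_hom ::
    "('r, 'x) ring_scheme \<Rightarrow> ('r, 'm) module \<Rightarrow> ('r, 't) module \<Rightarrow> 'm set \<Rightarrow> ('m \<Rightarrow> 't) set" where
  "quot_hom R M T M' = {f \<in> lmod_hom R M T. M' \<subseteq> a_kernel M T f}"

definition cogenerator_for ::
    "('r, 'x) ring_scheme \<Rightarrow> ('r, 't) module \<Rightarrow> ('r, 'n) module \<Rightarrow> bool" where
  "cogenerator_for R Q N \<longleftrightarrow> hom_ker N Q (lmod_hom R N Q) = {\<zero>\<^bsub>N\<^esub>}"


section \<open>Ideal filters\<close>

definition right_ideal :: "'r set \<Rightarrow> ('r, 'x) ring_scheme \<Rightarrow> bool" where
  "right_ideal I R \<longleftrightarrow>
     additive_subgroup I R \<and> (\<forall>a\<in>I. \<forall>r\<in>carrier R. a \<otimes>\<^bsub>R\<^esub> r \<in> I)"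

definition ideal_filter :: "('r, 'x) ring_scheme \<Rightarrow> 'r set set \<Rightarrow> bool" where
  "ideal_filter R J \<longleftrightarrow>
     J \<noteq> {} \<and> (\<forall>I\<in>J. right_ideal I R) \<and> (\<forall>I\<in>J. \<forall>I'\<in>J. I \<inter> I' \<in> J) \<and>
     (\<forall>I\<in>J. \<forall>I'. right_ideal I' R \<and> I \<subseteq> I' \<longrightarrow> I' \<in> J)"

text \<open>The submodule \<open>(A :\<^sub>B J)\<close> of \<open>B\<close>.\<close>

definition filter_colon :: "('r, 'b) module \<Rightarrow> 'b set \<Rightarrow> 'r set set \<Rightarrow> 'b set" where
  "filter_colon B A J = {x \<in> carrier B. \<exists>I\<in>J. \<forall>a\<in>I. a \<odot>\<^bsub>B\<^esub> x \<in> A}"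

definition filter_torsion :: "'r set set \<Rightarrow> ('r, 'b) module \<Rightarrow> bool" where
  "filter_torsion J B \<longleftrightarrow> filter_colon B {\<zero>\<^bsub>B\<^esub>} J = carrier B"

definition filter_extension ::
    "('r, 'x) ring_scheme \<Rightarrow> 'r set set \<Rightarrow> ('r, 'a) module \<Rightarrow> ('r, 'b) module \<Rightarrow> ('a \<Rightarrow> 'b) \<Rightarrow> bool" where
  "filter_extension R J A B i \<longleftrightarrow>
     left_module R A \<and> left_module R B \<and> i \<in> lmod_hom R A B \<and> inj_on i (carrier A) \<and>
     filter_colon B (i ` carrier A) J = carrier B"

text \<open>
  Completeness and \<open>J\<close>-injectivity quantify over all left \<open>R\<close>-modules. A formula of HOL can
  only quantify over the modules whose carrier is a subset of a given type, which is therefore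
  an explicit parameter. Instantiating it with the type of the elements of \<open>R\<close> already
  captures all modules over all types: see \<open>complete_filter_all_types\<close> and
  \<open>filter_injective_all_types\<close> below (the latter is Baer's criterion).
\<close>

definition complete_filter :: "'b itself \<Rightarrow> ('r, 'x) ring_scheme \<Rightarrow> 'r set set \<Rightarrow> bool" where
  "complete_filter (_ :: 'b itself) R J \<longleftrightarrow>
     (\<forall>(B :: ('r, 'b) module) A. left_module R B \<and> submodule A R B \<longrightarrow>
        filter_colon B (filter_colon B A J) J = filter_colon B A J)"

definition filter_injective ::
    "'b itself \<Rightarrow> ('r, 'x) ring_scheme \<Rightarrow> 'r set set \<Rightarrow> ('r, 'q) module \<Rightarrow> bool" where
  "filter_injective (_ :: 'b itself) R J Q \<longleftrightarrow>
     (\<forall>(A :: ('r, 'b) module) (B :: ('r, 'b) module) i f.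
        filter_extension R J A B i \<and> f \<in> lmod_hom R A Q \<longrightarrow>
        (\<exists>g \<in> lmod_hom R B Q. \<forall>a\<in>carrier A. g (i a) = f a))"


section \<open>Basic facts\<close>

context left_module
begin

lemma smult_l_null [simp]:
  assumes "x \<in> carrier M" shows "\<zero> \<odot>\<^bsub>M\<^esub> x = \<zero>\<^bsub>M\<^esub>"
proof -
  have "\<zero> \<odot>\<^bsub>M\<^esub> x = \<zero> \<odot>\<^bsub>M\<^esub> x \<oplus>\<^bsub>M\<^esub> \<zero> \<odot>\<^bsub>M\<^esub> x"
    using smult_l_distr[of \<zero> \<zero> x] assms by simp
  then show ?thesis
    using assms by (metis M.add.r_cancel_one' R.zero_closed smult_closed)
qed

lemma smult_r_null [simp]:
  assumes "a \<in> carrier R" shows "a \<odot>\<^bsub>M\<^esub> \<zero>\<^bsub>M\<^esub> = \<zero>\<^bsub>M\<^esub>"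
proof -
  have "a \<odot>\<^bsub>M\<^esub> \<zero>\<^bsub>M\<^esub> = a \<odot>\<^bsub>M\<^esub> \<zero>\<^bsub>M\<^esub> \<oplus>\<^bsub>M\<^esub> a \<odot>\<^bsub>M\<^esub> \<zero>\<^bsub>M\<^esub>"
    using smult_r_distr[of a "\<zero>\<^bsub>M\<^esub>" "\<zero>\<^bsub>M\<^esub>"] assms by simp
  then show ?thesis
    using assms by (metis M.add.r_cancel_one' M.zero_closed smult_closed)
qed

lemma smult_minus_one:
  assumes "x \<in> carrier M" shows "(\<ominus> \<one>) \<odot>\<^bsub>M\<^esub> x = \<ominus>\<^bsub>M\<^esub> x"
proof -
  have "(\<ominus> \<one>) \<odot>\<^bsub>M\<^esub> x \<oplus>\<^bsub>M\<^esub> x = (\<ominus> \<one> \<oplus> \<one>) \<odot>\<^bsub>M\<^esub> x"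
    using assms by (subst smult_l_distr) auto
  also have "\<dots> = \<zero>\<^bsub>M\<^esub>"
    using assms by (simp add: R.l_neg)
  finally show ?thesis
    using assms by (simp add: M.minus_equality)
qed

lemma left_submoduleI:
  assumes "H \<subseteq> carrier M" and "\<zero>\<^bsub>M\<^esub> \<in> H"
    and "\<And>a b. \<lbrakk>a \<in> H; b \<in> H\<rbrakk> \<Longrightarrow> a \<oplus>\<^bsub>M\<^esub> b \<in> H"
    and "\<And>a x. \<lbrakk>a \<in> carrier R; x \<in> H\<rbrakk> \<Longrightarrow> a \<odot>\<^bsub>M\<^esub> x \<in> H"
  shows "submodule H R M"
proof -
  have "\<ominus>\<^bsub>M\<^esub> x \<in> H" if "x \<in> H" for x
  proof -
    have "(\<ominus> \<one>) \<odot>\<^bsub>M\<^esub> x \<in> H"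
      using assms(4) that by simp
    then show ?thesis
      using smult_minus_one assms(1) that by auto
  qed
  then show ?thesis
    using assms
    by (intro submodule.intro subgroup.intro) (auto simp: submodule_axioms_def a_inv_def)
qed

lemma left_submoduleE:
  assumes "submodule H R M"
  shows "H \<subseteq> carrier M" and "\<zero>\<^bsub>M\<^esub> \<in> H"
    and "\<And>a b. \<lbrakk>a \<in> H; b \<in> H\<rbrakk> \<Longrightarrow> a \<oplus>\<^bsub>M\<^esub> b \<in> H"
    and "\<And>a x. \<lbrakk>a \<in> carrier R; x \<in> H\<rbrakk> \<Longrightarrow> a \<odot>\<^bsub>M\<^esub> x \<in> H"
    and "\<And>x. x \<in> H \<Longrightarrow> \<ominus>\<^bsub>M\<^esub> x \<in> H"
proof -
  interpret S: submodule H R M by fact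
  show "H \<subseteq> carrier M" using S.subset by simp
  show "\<zero>\<^bsub>M\<^esub> \<in> H" using S.one_closed by simp
  show "\<And>a b. \<lbrakk>a \<in> H; b \<in> H\<rbrakk> \<Longrightarrow> a \<oplus>\<^bsub>M\<^esub> b \<in> H" using S.m_closed by simp
  show "\<And>a x. \<lbrakk>a \<in> carrier R; x \<in> H\<rbrakk> \<Longrightarrow> a \<odot>\<^bsub>M\<^esub> x \<in> H" using S.smult_closed by simp
  show "\<And>x. x \<in> H \<Longrightarrow> \<ominus>\<^bsub>M\<^esub> x \<in> H" using S.m_inv_closed by (simp add: a_inv_def)
qed

end

lemma left_moduleI:
  fixes M :: "('r, 'm, 'y) module_scheme"
  assumes "ring R"
    and "\<And>x y. \<lbrakk>x \<in> carrier M; y \<in> carrier M\<rbrakk> \<Longrightarrow> x \<oplus>\<^bsub>M\<^esub> y \<in> carrier M"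
    and "\<zero>\<^bsub>M\<^esub> \<in> carrier M"
    and "\<And>x y z. \<lbrakk>x \<in> carrier M; y \<in> carrier M; z \<in> carrier M\<rbrakk> \<Longrightarrow>
          (x \<oplus>\<^bsub>M\<^esub> y) \<oplus>\<^bsub>M\<^esub> z = x \<oplus>\<^bsub>M\<^esub> (y \<oplus>\<^bsub>M\<^esub> z)"
    and "\<And>x y. \<lbrakk>x \<in> carrier M; y \<in> carrier M\<rbrakk> \<Longrightarrow> x \<oplus>\<^bsub>M\<^esub> y = y \<oplus>\<^bsub>M\<^esub> x"
    and "\<And>x. x \<in> carrier M \<Longrightarrow> \<zero>\<^bsub>M\<^esub> \<oplus>\<^bsub>M\<^esub> x = x"
    and "\<And>x. x \<in> carrier M \<Longrightarrow> \<exists>y \<in> carrier M. y \<oplus>\<^bsub>M\<^esub> x = \<zero>\<^bsub>M\<^esub>"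
    and "\<And>a x. \<lbrakk>a \<in> carrier R; x \<in> carrier M\<rbrakk> \<Longrightarrow> a \<odot>\<^bsub>M\<^esub> x \<in> carrier M"
    and "\<And>a b x. \<lbrakk>a \<in> carrier R; b \<in> carrier R; x \<in> carrier M\<rbrakk> \<Longrightarrow>
       (a \<oplus>\<^bsub>R\<^esub> b) \<odot>\<^bsub>M\<^esub> x = a \<odot>\<^bsub>M\<^esub> x \<oplus>\<^bsub>M\<^esub> b \<odot>\<^bsub>M\<^esub> x"
    and "\<And>a x y. \<lbrakk>a \<in> carrier R; x \<in> carrier M; y \<in> carrier M\<rbrakk> \<Longrightarrow>
       a \<odot>\<^bsub>M\<^esub> (x \<oplus>\<^bsub>M\<^esub> y) = a \<odot>\<^bsub>M\<^esub> x \<oplus>\<^bsub>M\<^esub> a \<odot>\<^bsub>M\<^esub> y"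
    and "\<And>a b x. \<lbrakk>a \<in> carrier R; b \<in> carrier R; x \<in> carrier M\<rbrakk> \<Longrightarrow>
       (a \<otimes>\<^bsub>R\<^esub> b) \<odot>\<^bsub>M\<^esub> x = a \<odot>\<^bsub>M\<^esub> (b \<odot>\<^bsub>M\<^esub> x)"
    and "\<And>x. x \<in> carrier M \<Longrightarrow> \<one>\<^bsub>R\<^esub> \<odot>\<^bsub>M\<^esub> x = x"
  shows "left_module R M"
proof -
  have "abelian_group M"
    by (rule abelian_groupI) (use assms in auto)
  then show ?thesis
    using assms by (intro left_module.intro left_module_axioms.intro) auto
qed

lemma lmod_homI:
  assumes "\<And>x. x \<in> carrier M \<Longrightarrow> f x \<in> carrier N" and "\<And>x. x \<notin> carrier M \<Longrightarrow> f x = undefined"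
    and "\<And>x y. \<lbrakk>x \<in> carrier M; y \<in> carrier M\<rbrakk> \<Longrightarrow> f (x \<oplus>\<^bsub>M\<^esub> y) = f x \<oplus>\<^bsub>N\<^esub> f y"
    and "\<And>a x. \<lbrakk>a \<in> carrier R; x \<in> carrier M\<rbrakk> \<Longrightarrow> f (a \<odot>\<^bsub>M\<^esub> x) = a \<odot>\<^bsub>N\<^esub> f x"
  shows "f \<in> lmod_hom R M N"
  using assms by (auto simp: lmod_hom_def PiE_def extensional_def)

lemma lmod_homD:
  assumes "f \<in> lmod_hom R M N"
  shows "x \<in> carrier M \<Longrightarrow> f x \<in> carrier N"
    and "f \<in> extensional (carrier M)"
    and "\<lbrakk>x \<in> carrier M; y \<in> carrier M\<rbrakk> \<Longrightarrow> f (x \<oplus>\<^bsub>M\<^esub> y) = f x \<oplus>\<^bsub>N\<^esub> f y"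
    and "\<lbrakk>a \<in> carrier R; x \<in> carrier M\<rbrakk> \<Longrightarrow> f (a \<odot>\<^bsub>M\<^esub> x) = a \<odot>\<^bsub>N\<^esub> f x"
  using assms by (auto simp: lmod_hom_def PiE_def)

lemma lmod_hom_zero:
  assumes "left_module R M" "left_module R N" "f \<in> lmod_hom R M N"
  shows "f \<zero>\<^bsub>M\<^esub> = \<zero>\<^bsub>N\<^esub>"
proof -
  interpret M: left_module R M by fact
  interpret N: left_module R N by fact
  have "f \<zero>\<^bsub>M\<^esub> = f (\<zero>\<^bsub>R\<^esub> \<odot>\<^bsub>M\<^esub> \<zero>\<^bsub>M\<^esub>)" by simp
  also have "\<dots> = \<zero>\<^bsub>R\<^esub> \<odot>\<^bsub>N\<^esub> f \<zero>\<^bsub>M\<^esub>"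
    by (rule lmod_homD(4)[OF assms(3)]) auto
  also have "\<dots> = \<zero>\<^bsub>N\<^esub>"
    using lmod_homD(1)[OF assms(3)] by simp
  finally show ?thesis .
qed

lemma lmod_hom_compose:
  assumes "left_module R M" "f \<in> lmod_hom R M N" "g \<in> lmod_hom R N P"
  shows "compose (carrier M) g f \<in> lmod_hom R M P"
proof -
  interpret M: left_module R M by fact
  show ?thesis
    by (rule lmod_homI) (simp_all add: compose_def lmod_homD[OF assms(2)] lmod_homD[OF assms(3)])
qed

lemma lmod_hom_add:
  assumes "left_module R M" "left_module R N" "f \<in> lmod_hom R M N" "g \<in> lmod_hom R M N"
  shows "(\<lambda>x\<in>carrier M. f x \<oplus>\<^bsub>N\<^esub> g x) \<in> lmod_hom R M N"
proof -
  interpret M: left_module R M by fact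
  interpret N: left_module R N by fact
  show ?thesis
    by (rule lmod_homI)
      (auto simp: lmod_homD[OF assms(3)] lmod_homD[OF assms(4)] N.smult_r_distr N.M.add.m_ac)
qed

lemma lmod_hom_zero_fun:
  assumes "left_module R M" "left_module R N"
  shows "(\<lambda>x\<in>carrier M. \<zero>\<^bsub>N\<^esub>) \<in> lmod_hom R M N"
proof -
  interpret M: left_module R M by fact
  interpret N: left_module R N by fact
  show ?thesis by (rule lmod_homI) auto
qed

lemma lmod_hom_uminus:
  assumes "left_module R M" "left_module R N" "f \<in> lmod_hom R M N"
  shows "(\<lambda>x\<in>carrier M. \<ominus>\<^bsub>N\<^esub> f x) \<in> lmod_hom R M N"
proof -
  interpret M: left_module R M by fact
  interpret N: left_module R N by fact
  have neg: "\<ominus>\<^bsub>N\<^esub> (a \<odot>\<^bsub>N\<^esub> x) = a \<odot>\<^bsub>N\<^esub> (\<ominus>\<^bsub>N\<^esub> x)"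
    if "a \<in> carrier R" "x \<in> carrier N" for a x
  proof (rule N.M.minus_equality)
    have "a \<odot>\<^bsub>N\<^esub> (\<ominus>\<^bsub>N\<^esub> x) \<oplus>\<^bsub>N\<^esub> a \<odot>\<^bsub>N\<^esub> x = a \<odot>\<^bsub>N\<^esub> (\<ominus>\<^bsub>N\<^esub> x \<oplus>\<^bsub>N\<^esub> x)"
      using that by (subst N.smult_r_distr) auto
    then show "a \<odot>\<^bsub>N\<^esub> (\<ominus>\<^bsub>N\<^esub> x) \<oplus>\<^bsub>N\<^esub> a \<odot>\<^bsub>N\<^esub> x = \<zero>\<^bsub>N\<^esub>"
      using that by (simp add: N.M.l_neg)
  qed (use that in auto)
  show ?thesis
    by (rule lmod_homI) (auto simp: lmod_homD[OF assms(3)] neg N.M.minus_add)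
qed

text \<open>The constructions above are a ring and left modules, and \<open>Hom\<^sub>R(M/M', T)\<close> is identified correctly.\<close>

lemma ring_End_ring:
  assumes "left_module R T"
  shows "ring (End_ring R T)"
proof -
  interpret T: left_module R T by fact
  note [simp] = End_ring_def
  have E: "e \<in> extensional (carrier T)" if "e \<in> lmod_hom R T T" for e
    using that by (rule lmod_homD(2))
  have "abelian_group (End_ring R T)"
  proof (rule abelian_groupI)
    fix e assume "e \<in> carrier (End_ring R T)"
    then have e: "e \<in> lmod_hom R T T" by simp
    show "\<zero>\<^bsub>End_ring R T\<^esub> \<oplus>\<^bsub>End_ring R T\<^esub> e = e"
      using e E[OF e] by (auto simp: fun_eq_iff extensional_def lmod_homD(1))
    show "\<exists>y\<in>carrier (End_ring R T). y \<oplus>\<^bsub>End_ring R T\<^esub> e = \<zero>\<^bsub>End_ring R T\<^esub>"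
      using e by (intro bexI[of _ "\<lambda>x\<in>carrier T. \<ominus>\<^bsub>T\<^esub> e x"])
        (auto simp: lmod_hom_uminus[OF assms assms] lmod_homD(1) T.M.l_neg)
  qed (auto simp: lmod_hom_add[OF assms assms] lmod_hom_zero_fun[OF assms assms] fun_eq_iff
      T.M.add.m_ac lmod_homD(1))
  moreover have "monoid (End_ring R T)"
  proof (rule monoidI)
    fix e assume "e \<in> carrier (End_ring R T)"
    then have e: "e \<in> lmod_hom R T T" by simp
    show "\<one>\<^bsub>End_ring R T\<^esub> \<otimes>\<^bsub>End_ring R T\<^esub> e = e" "e \<otimes>\<^bsub>End_ring R T\<^esub> \<one>\<^bsub>End_ring R T\<^esub> = e"
      using e E[OF e] by (auto simp: fun_eq_iff compose_def extensional_def lmod_homD(1))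
  next
    show "\<one>\<^bsub>End_ring R T\<^esub> \<in> carrier (End_ring R T)"
      by (auto intro!: lmod_homI)
  next
    fix e f assume "e \<in> carrier (End_ring R T)" "f \<in> carrier (End_ring R T)"
    then show "e \<otimes>\<^bsub>End_ring R T\<^esub> f \<in> carrier (End_ring R T)"
      using lmod_hom_compose[OF assms] by simp
  qed (auto simp: compose_def fun_eq_iff lmod_homD(1))
  ultimately show ?thesis
    by (intro ringI) (auto simp: compose_def fun_eq_iff lmod_homD(1,3))
qed

lemma left_module_Hom_module:
  assumes "left_module R M" "left_module R T"
  shows "left_module (End_ring R T) (Hom_module R M T)"
proof -
  interpret M: left_module R M by fact
  interpret T: left_module R T by fact
  note [simp] = Hom_module_def End_ring_def compose_def
  note compose = lmod_hom_compose[OF assms(1), unfolded compose_def]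
  show ?thesis
  proof (rule left_moduleI)
    show "ring (End_ring R T)" by (rule ring_End_ring) fact
  next
    fix f assume "f \<in> carrier (Hom_module R M T)"
    then have f: "f \<in> lmod_hom R M T" by simp
    show "\<exists>y\<in>carrier (Hom_module R M T). y \<oplus>\<^bsub>Hom_module R M T\<^esub> f = \<zero>\<^bsub>Hom_module R M T\<^esub>"
      using f by (intro bexI[of _ "\<lambda>x\<in>carrier M. \<ominus>\<^bsub>T\<^esub> f x"])
        (auto simp: lmod_hom_uminus[OF assms] lmod_homD(1) T.M.l_neg)
    show "\<zero>\<^bsub>Hom_module R M T\<^esub> \<oplus>\<^bsub>Hom_module R M T\<^esub> f = f"
      "\<one>\<^bsub>End_ring R T\<^esub> \<odot>\<^bsub>Hom_module R M T\<^esub> f = f"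
      using f lmod_homD(2)[OF f] by (auto simp: fun_eq_iff extensional_def lmod_homD(1))
  next
    fix e f assume "e \<in> carrier (End_ring R T)" "f \<in> carrier (Hom_module R M T)"
    then show "e \<odot>\<^bsub>Hom_module R M T\<^esub> f \<in> carrier (Hom_module R M T)"
      using compose by simp
  qed (auto simp: lmod_hom_add[OF assms] lmod_hom_zero_fun[OF assms] fun_eq_iff
      T.M.add.m_ac lmod_homD(1,3))
qed


context left_module
begin

lemma abelian_subgroup_submodule:
  assumes "submodule N R M"
  shows "abelian_subgroup N M"
  using assms by (intro abelian_subgroupI3 additive_subgroup.intro)
    (auto simp: submodule_def M.abelian_group_axioms)

lemma coset_eq_iff:
  assumes "submodule N R M" "x \<in> carrier M" "y \<in> carrier M"
  shows "N +>\<^bsub>M\<^esub> x = N +>\<^bsub>M\<^esub> y \<longleftrightarrow> x \<oplus>\<^bsub>M\<^esub> \<ominus>\<^bsub>M\<^esub> y \<in> N"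
proof -
  interpret S: abelian_subgroup N M
    by (rule abelian_subgroup_submodule) fact
  show ?thesis
    using assms S.a_rcos_module S.a_rcos_self S.a_repr_independence' by metis
qed

lemma coset_smult:
  assumes "submodule N R M" "x \<in> carrier M" "a \<in> carrier R"
  shows "(\<Union>y\<in>N +>\<^bsub>M\<^esub> x. N +>\<^bsub>M\<^esub> (a \<odot>\<^bsub>M\<^esub> y)) = N +>\<^bsub>M\<^esub> (a \<odot>\<^bsub>M\<^esub> x)"
proof -
  interpret S: abelian_subgroup N M
    by (rule abelian_subgroup_submodule) fact
  note N = left_submoduleE[OF assms(1)]
  have "N +>\<^bsub>M\<^esub> (a \<odot>\<^bsub>M\<^esub> y) = N +>\<^bsub>M\<^esub> (a \<odot>\<^bsub>M\<^esub> x)" if y: "y \<in> N +>\<^bsub>M\<^esub> x" for y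
  proof -
    obtain n where n: "n \<in> N" "y = n \<oplus>\<^bsub>M\<^esub> x"
      using y by (auto simp: a_r_coset_def')
    then have "n \<in> carrier M" using N(1) by auto
    then have "a \<odot>\<^bsub>M\<^esub> y \<oplus>\<^bsub>M\<^esub> \<ominus>\<^bsub>M\<^esub> (a \<odot>\<^bsub>M\<^esub> x) = a \<odot>\<^bsub>M\<^esub> n"
      using assms n by (simp add: smult_r_distr M.a_assoc M.r_neg)
    then show ?thesis
      using assms n N \<open>n \<in> carrier M\<close> by (subst coset_eq_iff) auto
  qed
  moreover have "x \<in> N +>\<^bsub>M\<^esub> x" using assms by (simp add: S.a_rcos_self)
  ultimately show ?thesis by blast
qed

end

lemma quot_module_simps:
  assumes "left_module R M" "submodule N R M"
  shows "carrier (quot_module M N) = (\<lambda>x. N +>\<^bsub>M\<^esub> x) ` carrier M"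
    and "\<lbrakk>x \<in> carrier M; y \<in> carrier M\<rbrakk> \<Longrightarrow>
       (N +>\<^bsub>M\<^esub> x) \<oplus>\<^bsub>quot_module M N\<^esub> (N +>\<^bsub>M\<^esub> y) = N +>\<^bsub>M\<^esub> (x \<oplus>\<^bsub>M\<^esub> y)"
    and "\<zero>\<^bsub>quot_module M N\<^esub> = N +>\<^bsub>M\<^esub> \<zero>\<^bsub>M\<^esub>"
    and "\<lbrakk>x \<in> carrier M; a \<in> carrier R\<rbrakk> \<Longrightarrow>
       a \<odot>\<^bsub>quot_module M N\<^esub> (N +>\<^bsub>M\<^esub> x) = N +>\<^bsub>M\<^esub> (a \<odot>\<^bsub>M\<^esub> x)"
proof -
  interpret M: left_module R M by fact
  interpret S: abelian_subgroup N M
    by (rule M.abelian_subgroup_submodule) fact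
  show "carrier (quot_module M N) = (\<lambda>x. N +>\<^bsub>M\<^esub> x) ` carrier M"
    by (auto simp: quot_module_def A_RCOSETS_def')
  show "\<lbrakk>x \<in> carrier M; y \<in> carrier M\<rbrakk> \<Longrightarrow>
       (N +>\<^bsub>M\<^esub> x) \<oplus>\<^bsub>quot_module M N\<^esub> (N +>\<^bsub>M\<^esub> y) = N +>\<^bsub>M\<^esub> (x \<oplus>\<^bsub>M\<^esub> y)"
    by (simp add: quot_module_def S.a_rcos_sum)
  show "\<zero>\<^bsub>quot_module M N\<^esub> = N +>\<^bsub>M\<^esub> \<zero>\<^bsub>M\<^esub>"
    by (simp add: quot_module_def S.a_subset)
  show "\<lbrakk>x \<in> carrier M; a \<in> carrier R\<rbrakk> \<Longrightarrow>
       a \<odot>\<^bsub>quot_module M N\<^esub> (N +>\<^bsub>M\<^esub> x) = N +>\<^bsub>M\<^esub> (a \<odot>\<^bsub>M\<^esub> x)"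
    by (simp add: quot_module_def M.coset_smult[OF assms(2)])
qed

lemma left_module_quot_module:
  assumes "left_module R M" "submodule N R M"
  shows "left_module R (quot_module M N)"
proof -
  interpret M: left_module R M by fact
  note q = quot_module_simps[OF assms]
  show ?thesis
  proof (rule left_moduleI)
    fix X assume "X \<in> carrier (quot_module M N)"
    then obtain x where x: "x \<in> carrier M" "X = N +>\<^bsub>M\<^esub> x" by (auto simp: q)
    show "\<exists>y\<in>carrier (quot_module M N). y \<oplus>\<^bsub>quot_module M N\<^esub> X = \<zero>\<^bsub>quot_module M N\<^esub>"
      using x by (intro bexI[of _ "N +>\<^bsub>M\<^esub> (\<ominus>\<^bsub>M\<^esub> x)"]) (auto simp: q M.M.l_neg)
  qed (auto simp: q M.R.ring_axioms M.M.add.m_ac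
      M.smult_l_distr M.smult_r_distr M.smult_assoc1)
qed

lemma bij_betw_quot_hom:
  assumes "left_module R M" "submodule N R M" "left_module R T"
  shows "bij_betw (\<lambda>\<phi>. \<lambda>x\<in>carrier M. \<phi> (N +>\<^bsub>M\<^esub> x))
           (lmod_hom R (quot_module M N) T) (quot_hom R M T N)"
proof -
  interpret M: left_module R M by fact
  interpret T: left_module R T by fact
  interpret Q: left_module R "quot_module M N" by (rule left_module_quot_module) fact+
  interpret S: abelian_subgroup N M by (rule M.abelian_subgroup_submodule) fact
  note q = quot_module_simps[OF assms(1,2)]
  let ?F = "\<lambda>\<phi>. \<lambda>x\<in>carrier M. \<phi> (N +>\<^bsub>M\<^esub> x)"
  show ?thesis
  proof (rule bij_betw_imageI)
    show "inj_on ?F (lmod_hom R (quot_module M N) T)"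
    proof (rule inj_onI)
      fix \<phi> \<psi> assume h: "\<phi> \<in> lmod_hom R (quot_module M N) T" "\<psi> \<in> lmod_hom R (quot_module M N) T"
        and eq: "?F \<phi> = ?F \<psi>"
      show "\<phi> = \<psi>"
      proof (rule extensionalityI[OF lmod_homD(2)[OF h(1)] lmod_homD(2)[OF h(2)]])
        fix X assume "X \<in> carrier (quot_module M N)"
        then obtain x where x: "x \<in> carrier M" "X = N +>\<^bsub>M\<^esub> x" by (auto simp: q)
        show "\<phi> X = \<psi> X"
          using fun_cong[OF eq, of x] x by simp
      qed
    qed
    show "?F ` lmod_hom R (quot_module M N) T = quot_hom R M T N"
    proof (intro equalityI subsetI)
      fix f assume "f \<in> ?F ` lmod_hom R (quot_module M N) T"
      then obtain \<phi> where \<phi>: "\<phi> \<in> lmod_hom R (quot_module M N) T" "f = ?F \<phi>" by auto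
      have "f \<in> lmod_hom R M T"
        unfolding \<phi>(2)
      proof (rule lmod_homI)
        fix x y assume "x \<in> carrier M" "y \<in> carrier M"
        then show "?F \<phi> (x \<oplus>\<^bsub>M\<^esub> y) = ?F \<phi> x \<oplus>\<^bsub>T\<^esub> ?F \<phi> y"
          using lmod_homD(3)[OF \<phi>(1), of "N +>\<^bsub>M\<^esub> x" "N +>\<^bsub>M\<^esub> y"] by (simp add: q)
      next
        fix a x assume "a \<in> carrier R" "x \<in> carrier M"
        then show "?F \<phi> (a \<odot>\<^bsub>M\<^esub> x) = a \<odot>\<^bsub>T\<^esub> ?F \<phi> x"
          using lmod_homD(4)[OF \<phi>(1), of a "N +>\<^bsub>M\<^esub> x"] by (simp add: q)
      qed (auto intro!: lmod_homD(1)[OF \<phi>(1)] simp: q)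
      moreover have "f n = \<zero>\<^bsub>T\<^esub>" if "n \<in> N" for n
      proof -
        have "f n = \<phi> \<zero>\<^bsub>quot_module M N\<^esub>"
          using that by (simp add: \<phi>(2) q S.a_rcos_const S.a_subset)
        then show ?thesis
          using lmod_hom_zero[OF Q.left_module_axioms assms(3) \<phi>(1)] by simp
      qed
      ultimately show "f \<in> quot_hom R M T N"
        by (auto simp: quot_hom_def a_kernel_def')
    next
      fix f assume "f \<in> quot_hom R M T N"
      then have f: "f \<in> lmod_hom R M T" and f0: "\<And>n. n \<in> N \<Longrightarrow> f n = \<zero>\<^bsub>T\<^esub>"
        by (auto simp: quot_hom_def a_kernel_def')
      define \<phi> where "\<phi> = (\<lambda>X\<in>carrier (quot_module M N). f (SOME x. x \<in> X))"
      have \<phi>: "\<phi> (N +>\<^bsub>M\<^esub> x) = f x" if x: "x \<in> carrier M" for x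
      proof -
        have "(SOME y. y \<in> N +>\<^bsub>M\<^esub> x) \<in> N +>\<^bsub>M\<^esub> x"
          using S.a_rcos_self[OF x] by (rule someI)
        then obtain n where n: "n \<in> N" "(SOME y. y \<in> N +>\<^bsub>M\<^esub> x) = n \<oplus>\<^bsub>M\<^esub> x"
          by (auto simp: a_r_coset_def')
        then show ?thesis
          using x f0[of n] lmod_homD(1,3)[OF f] by (simp add: \<phi>_def q)
      qed
      have "\<phi> \<in> lmod_hom R (quot_module M N) T"
      proof (rule lmod_homI)
        show "\<phi> X = undefined" if "X \<notin> carrier (quot_module M N)" for X
          using that by (simp add: \<phi>_def)
      qed (auto simp: q \<phi> lmod_homD[OF f])
      moreover have "f = ?F \<phi>"
        using \<phi> lmod_homD(2)[OF f] by (auto simp: fun_eq_iff extensional_def)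
      ultimately show "f \<in> ?F ` lmod_hom R (quot_module M N) T"
        by blast
    qed
  qed
qed


section \<open>Independence of the type parameter\<close>

definition regular_module :: "('r, 'x) ring_scheme \<Rightarrow> ('r, 'r) module" where
  "regular_module R =
     \<lparr>carrier = carrier R, mult = undefined, one = undefined,
      zero = \<zero>\<^bsub>R\<^esub>, add = add R, smult = mult R\<rparr>"

lemma regular_module_simps [simp]:
  "carrier (regular_module R) = carrier R" "\<zero>\<^bsub>regular_module R\<^esub> = \<zero>\<^bsub>R\<^esub>"
  "add (regular_module R) = add R" "smult (regular_module R) = mult R"
  by (simp_all add: regular_module_def)

lemma left_module_regular_module:
  assumes "ring R" shows "left_module R (regular_module R)"
proof -
  interpret R: ring R by fact
  show ?thesis
  proof (rule left_moduleI)
    show "\<exists>y\<in>carrier (regular_module R). y \<oplus>\<^bsub>regular_module R\<^esub> x = \<zero>\<^bsub>regular_module R\<^esub>"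
      if "x \<in> carrier (regular_module R)" for x
      using that by (intro bexI[of _ "\<ominus>\<^bsub>R\<^esub> x"]) (simp_all add: R.l_neg)
  qed (simp_all add: assms R.add.m_ac R.l_distr R.r_distr R.m_assoc)
qed

lemma left_module_restrict:
  assumes "left_module R M" "submodule H R M"
  shows "left_module R (M\<lparr>carrier := H\<rparr>)"
proof -
  interpret M: left_module R M by fact
  note H = M.left_submoduleE[OF assms(2)]
  note C = subsetD[OF H(1)]
  show ?thesis
  proof (rule left_moduleI)
    show "\<exists>y\<in>carrier (M\<lparr>carrier := H\<rparr>). y \<oplus>\<^bsub>M\<lparr>carrier := H\<rparr>\<^esub> x = \<zero>\<^bsub>M\<lparr>carrier := H\<rparr>\<^esub>"
      if "x \<in> carrier (M\<lparr>carrier := H\<rparr>)" for x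
      using that H(5)[of x] by (intro bexI[of _ "\<ominus>\<^bsub>M\<^esub> x"]) (simp_all add: C M.M.l_neg)
  qed (simp_all add: C H(2-4) M.R.ring_axioms M.M.add.m_ac
      M.smult_l_distr M.smult_r_distr M.smult_assoc1)
qed

lemma submodule_annihilator:
  assumes "left_module R B" "submodule A R B" "x \<in> carrier B"
  shows "submodule {r \<in> carrier R. r \<odot>\<^bsub>B\<^esub> x \<in> A} R (regular_module R)"
proof -
  interpret B: left_module R B by fact
  interpret RR: left_module R "regular_module R"
    by (rule left_module_regular_module) (rule B.R.ring_axioms)
  note A = B.left_submoduleE[OF assms(2)]
  show ?thesis
    using A assms(3)
    by (intro RR.left_submoduleI) (auto simp: B.smult_l_distr B.smult_assoc1)
qed

lemma ideal_filterD:
  assumes "ideal_filter R J" "I \<in> J"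
  shows "I \<subseteq> carrier R" and "\<lbrakk>a \<in> I; r \<in> carrier R\<rbrakk> \<Longrightarrow> a \<otimes>\<^bsub>R\<^esub> r \<in> I"
    and "I' \<in> J \<Longrightarrow> I \<inter> I' \<in> J"
proof -
  have I: "right_ideal I R" and inter: "\<forall>I'\<in>J. I \<inter> I' \<in> J"
    using assms unfolding ideal_filter_def by blast+
  show "I \<subseteq> carrier R"
    using I additive_subgroup.a_subset[of I R] unfolding right_ideal_def by blast
  show "\<lbrakk>a \<in> I; r \<in> carrier R\<rbrakk> \<Longrightarrow> a \<otimes>\<^bsub>R\<^esub> r \<in> I"
    using I unfolding right_ideal_def by blast
  show "I' \<in> J \<Longrightarrow> I \<inter> I' \<in> J"
    using inter by blast
qed

lemma submodule_filter_colon: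
  assumes "left_module R B" "submodule A R B" "ideal_filter R J"
  shows "submodule (filter_colon B A J) R B" and "A \<subseteq> filter_colon B A J"
proof -
  interpret B: left_module R B by fact
  note A = B.left_submoduleE[OF assms(2)]
  note J = ideal_filterD[OF assms(3)]
  obtain I0 where I0: "I0 \<in> J" using assms(3) by (auto simp: ideal_filter_def)
  show sub: "A \<subseteq> filter_colon B A J"
  proof
    fix x assume x: "x \<in> A"
    then have "\<forall>a\<in>I0. a \<odot>\<^bsub>B\<^esub> x \<in> A" using J(1)[OF I0] A(4) by blast
    then show "x \<in> filter_colon B A J" using I0 x A(1) unfolding filter_colon_def by blast
  qed
  show "submodule (filter_colon B A J) R B"
  proof (rule B.left_submoduleI)
    fix x y assume "x \<in> filter_colon B A J" "y \<in> filter_colon B A J"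
    then obtain I I' where I: "x \<in> carrier B" "y \<in> carrier B" "I \<in> J" "I' \<in> J"
      "\<forall>a\<in>I. a \<odot>\<^bsub>B\<^esub> x \<in> A" "\<forall>a\<in>I'. a \<odot>\<^bsub>B\<^esub> y \<in> A"
      by (auto simp: filter_colon_def)
    have "a \<odot>\<^bsub>B\<^esub> (x \<oplus>\<^bsub>B\<^esub> y) \<in> A" if "a \<in> I \<inter> I'" for a
      using that I A(3) J(1)[OF I(3)] by (subst B.smult_r_distr) auto
    then show "x \<oplus>\<^bsub>B\<^esub> y \<in> filter_colon B A J"
      using I(1,2) J(3)[OF I(3,4)] B.M.a_closed unfolding filter_colon_def by blast
  next
    fix r x assume r: "r \<in> carrier R" and "x \<in> filter_colon B A J"
    then obtain I where I: "x \<in> carrier B" "I \<in> J" "\<forall>a\<in>I. a \<odot>\<^bsub>B\<^esub> x \<in> A"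
      by (auto simp: filter_colon_def)
    have "a \<odot>\<^bsub>B\<^esub> (r \<odot>\<^bsub>B\<^esub> x) \<in> A" if a: "a \<in> I" for a
    proof -
      have "(a \<otimes>\<^bsub>R\<^esub> r) \<odot>\<^bsub>B\<^esub> x \<in> A" using I(3) J(2)[OF I(2) a r] by blast
      then show ?thesis using J(1)[OF I(2)] a r I(1) by (subst (asm) B.smult_assoc1) auto
    qed
    then show "r \<odot>\<^bsub>B\<^esub> x \<in> filter_colon B A J"
      using I(1,2) r B.smult_closed unfolding filter_colon_def by blast
  next
    show "filter_colon B A J \<subseteq> carrier B" by (auto simp: filter_colon_def)
    show "\<zero>\<^bsub>B\<^esub> \<in> filter_colon B A J" using sub A(2) by blast
  qed
qed

lemma complete_filter_all_types:
  fixes R :: "('r, 'x) ring_scheme"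
  assumes J: "ideal_filter R J" and complete: "complete_filter TYPE('r) R J"
  shows "complete_filter TYPE('b) R J"
  unfolding complete_filter_def
proof (intro allI impI, elim conjE)
  fix B :: "('r, 'b) module" and A
  assume B: "left_module R B" and A: "submodule A R B"
  interpret B: left_module R B by fact
  note colon = submodule_filter_colon[OF B A J]
  show "filter_colon B (filter_colon B A J) J = filter_colon B A J"
  proof (intro equalityI subsetI)
    fix x assume "x \<in> filter_colon B A J"
    then show "x \<in> filter_colon B (filter_colon B A J) J"
      using submodule_filter_colon(2)[OF B colon(1) J] by auto
  next
    fix x assume "x \<in> filter_colon B (filter_colon B A J) J"
    then obtain I where x: "x \<in> carrier B" "I \<in> J" "\<forall>a\<in>I. a \<odot>\<^bsub>B\<^esub> x \<in> filter_colon B A J"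
      by (auto simp: filter_colon_def)
    define L where "L = {r \<in> carrier R. r \<odot>\<^bsub>B\<^esub> x \<in> A}"
    have mem: "r \<in> filter_colon (regular_module R) L J \<longleftrightarrow> r \<odot>\<^bsub>B\<^esub> x \<in> filter_colon B A J"
      if r: "r \<in> carrier R" for r
      using x(1) r ideal_filterD(1)[OF J]
      by (auto simp: filter_colon_def L_def B.smult_assoc1 subset_iff intro!: bex_cong)
    have "I \<subseteq> filter_colon (regular_module R) L J"
      using x(3) mem ideal_filterD(1)[OF J x(2)] by auto
    then have "\<one>\<^bsub>R\<^esub> \<in> filter_colon (regular_module R) (filter_colon (regular_module R) L J) J"
      using x(2) ideal_filterD(1)[OF J x(2)]
      by (subst filter_colon_def) (auto simp: subset_iff intro!: bexI[of _ I])
    also have "\<dots> = filter_colon (regular_module R) L J"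
      using complete left_module_regular_module[OF B.R.ring_axioms]
        submodule_annihilator[OF B A x(1)]
      unfolding complete_filter_def L_def by blast
    finally show "x \<in> filter_colon B A J"
      using mem[of "\<one>\<^bsub>R\<^esub>"] x(1) by simp
  qed
qed

text \<open>The partial extensions of \<open>f\<close> along \<open>i\<close> are represented by their graphs.\<close>

lemma filter_injective_extends:
  fixes R :: "('r, 'x) ring_scheme"
  assumes J: "ideal_filter R J" and Q: "left_module R Q" and inj: "filter_injective TYPE('r) R J Q"
    and ext: "filter_extension R J A B i" and f: "f \<in> lmod_hom R A Q"
  shows "\<exists>g \<in> lmod_hom R B Q. \<forall>a\<in>carrier A. g (i a) = f a"
proof -
  interpret R: ring R by (rule left_module.axioms(1)[OF Q])
  interpret Q: left_module R Q by fact
  have A: "left_module R A" and B: "left_module R B" and i: "i \<in> lmod_hom R A B"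
    and i_inj: "inj_on i (carrier A)" and colon: "filter_colon B (i ` carrier A) J = carrier B"
    using ext by (auto simp: filter_extension_def)
  interpret A: left_module R A by fact
  interpret B: left_module R B by fact
  define G0 where "G0 = (\<lambda>a. (i a, f a)) ` carrier A"
  define \<G> where "\<G> = {G. G \<subseteq> carrier B \<times> carrier Q \<and> G0 \<subseteq> G \<and>
     (\<forall>x p y q. (x, p) \<in> G \<longrightarrow> (y, q) \<in> G \<longrightarrow> (x \<oplus>\<^bsub>B\<^esub> y, p \<oplus>\<^bsub>Q\<^esub> q) \<in> G) \<and>
     (\<forall>r\<in>carrier R. \<forall>x p. (x, p) \<in> G \<longrightarrow> (r \<odot>\<^bsub>B\<^esub> x, r \<odot>\<^bsub>Q\<^esub> p) \<in> G) \<and>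
     (\<forall>x p q. (x, p) \<in> G \<longrightarrow> (x, q) \<in> G \<longrightarrow> p = q)}"
  have \<G>D: "G \<subseteq> carrier B \<times> carrier Q" "G0 \<subseteq> G"
      "\<And>x p y q. \<lbrakk>(x, p) \<in> G; (y, q) \<in> G\<rbrakk> \<Longrightarrow> (x \<oplus>\<^bsub>B\<^esub> y, p \<oplus>\<^bsub>Q\<^esub> q) \<in> G"
      "\<And>r x p. \<lbrakk>r \<in> carrier R; (x, p) \<in> G\<rbrakk> \<Longrightarrow> (r \<odot>\<^bsub>B\<^esub> x, r \<odot>\<^bsub>Q\<^esub> p) \<in> G"
      "\<And>x p q. \<lbrakk>(x, p) \<in> G; (x, q) \<in> G\<rbrakk> \<Longrightarrow> p = q"
    if "G \<in> \<G>" for G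
    using that unfolding \<G>_def mem_Collect_eq by meson+
  have "G0 \<in> \<G>"
    unfolding \<G>_def
  proof (rule CollectI, intro conjI allI impI ballI)
    show "G0 \<subseteq> carrier B \<times> carrier Q"
      by (auto simp: G0_def lmod_homD(1)[OF i] lmod_homD(1)[OF f])
  next
    fix x p y q assume "(x, p) \<in> G0" "(y, q) \<in> G0"
    then obtain a b where "a \<in> carrier A" "b \<in> carrier A" "x = i a" "p = f a" "y = i b" "q = f b"
      by (auto simp: G0_def)
    then show "(x \<oplus>\<^bsub>B\<^esub> y, p \<oplus>\<^bsub>Q\<^esub> q) \<in> G0"
      unfolding G0_def
      by (intro image_eqI[of _ _ "a \<oplus>\<^bsub>A\<^esub> b"]) (simp_all add: lmod_homD(3)[OF i] lmod_homD(3)[OF f])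
  next
    fix r x p assume "r \<in> carrier R" "(x, p) \<in> G0"
    moreover then obtain a where "a \<in> carrier A" "x = i a" "p = f a"
      by (auto simp: G0_def)
    ultimately show "(r \<odot>\<^bsub>B\<^esub> x, r \<odot>\<^bsub>Q\<^esub> p) \<in> G0"
      unfolding G0_def
      by (intro image_eqI[of _ _ "r \<odot>\<^bsub>A\<^esub> a"]) (simp_all add: lmod_homD(4)[OF i] lmod_homD(4)[OF f])
  next
    fix x p q assume "(x, p) \<in> G0" "(x, q) \<in> G0"
    then show "p = q"
      using inj_onD[OF i_inj] by (auto simp: G0_def)
  qed simp
  moreover have "\<Union>C \<in> \<G>" if "C \<noteq> {}" "subset.chain \<G> C" for C
  proof -
    have C: "G \<in> \<G>" if "G \<in> C" for G
      using \<open>subset.chain \<G> C\<close> that by (auto simp: subset_chain_def)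
    have dir: "\<exists>G\<in>C. u \<in> G \<and> v \<in> G" if uv: "u \<in> \<Union>C" "v \<in> \<Union>C" for u v
    proof -
      obtain G G' where G: "G \<in> C" "u \<in> G" "G' \<in> C" "v \<in> G'" using uv by blast
      then have "G \<subseteq> G' \<or> G' \<subseteq> G"
        using \<open>subset.chain \<G> C\<close> by (simp add: subset_chain_def)
      then show ?thesis using G by blast
    qed
    show ?thesis
      unfolding \<G>_def
    proof (rule CollectI, intro conjI allI impI ballI)
      show "\<Union>C \<subseteq> carrier B \<times> carrier Q" using \<G>D(1)[OF C] by blast
      show "G0 \<subseteq> \<Union>C" using \<G>D(2)[OF C] \<open>C \<noteq> {}\<close> by blast
    next
      fix x p y q assume "(x, p) \<in> \<Union>C" "(y, q) \<in> \<Union>C"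
      then obtain G where "G \<in> C" "(x, p) \<in> G" "(y, q) \<in> G" using dir by blast
      then show "(x \<oplus>\<^bsub>B\<^esub> y, p \<oplus>\<^bsub>Q\<^esub> q) \<in> \<Union>C" using \<G>D(3)[OF C] by blast
    next
      fix r x p assume "r \<in> carrier R" "(x, p) \<in> \<Union>C"
      then obtain G where "G \<in> C" "(x, p) \<in> G" by blast
      then show "(r \<odot>\<^bsub>B\<^esub> x, r \<odot>\<^bsub>Q\<^esub> p) \<in> \<Union>C"
        using \<G>D(4)[OF C] \<open>r \<in> carrier R\<close> by blast
    next
      fix x p q assume "(x, p) \<in> \<Union>C" "(x, q) \<in> \<Union>C"
      then obtain G where "G \<in> C" "(x, p) \<in> G" "(x, q) \<in> G" using dir by blast
      then show "p = q" using \<G>D(5)[OF C] by blast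
    qed
  qed
  ultimately obtain G where G: "G \<in> \<G>" and max: "\<And>H. \<lbrakk>H \<in> \<G>; G \<subseteq> H\<rbrakk> \<Longrightarrow> H = G"
    using subset_Zorn_nonempty[of \<G>] by blast
  have Gcarr: "x \<in> carrier B \<and> p \<in> carrier Q" if "(x, p) \<in> G" for x p
    using \<G>D(1)[OF G] that by blast
  have G0: "(i a, f a) \<in> G" if "a \<in> carrier A" for a
    using \<G>D(2)[OF G] that unfolding G0_def by blast
  note Gadd = \<G>D(3)[OF G] and Gsmult = \<G>D(4)[OF G] and Guniq = \<G>D(5)[OF G]
  have Gzero: "(\<zero>\<^bsub>B\<^esub>, \<zero>\<^bsub>Q\<^esub>) \<in> G"
    using G0[of "\<zero>\<^bsub>A\<^esub>"] lmod_hom_zero[OF A B i] lmod_hom_zero[OF A Q f] by simp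
  have Gminus: "(\<ominus>\<^bsub>B\<^esub> x, \<ominus>\<^bsub>Q\<^esub> p) \<in> G" if "(x, p) \<in> G" for x p
    using Gsmult[of "\<ominus>\<^bsub>R\<^esub> \<one>\<^bsub>R\<^esub>", OF _ that] Gcarr[OF that]
    by (simp add: B.smult_minus_one Q.smult_minus_one)
  have D: "submodule (Domain G) R B"
  proof (rule B.left_submoduleI)
    show "Domain G \<subseteq> carrier B" using Gcarr by blast
    show "\<zero>\<^bsub>B\<^esub> \<in> Domain G" using Gzero by blast
    show "x \<oplus>\<^bsub>B\<^esub> y \<in> Domain G" if "x \<in> Domain G" "y \<in> Domain G" for x y
      using that by (blast dest: Gadd)
    show "r \<odot>\<^bsub>B\<^esub> x \<in> Domain G" if "r \<in> carrier R" "x \<in> Domain G" for r x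
      using that by (blast dest: Gsmult)
  qed
  have "Domain G = carrier B"
  proof (rule ccontr)
    assume "Domain G \<noteq> carrier B"
    then obtain x where x: "x \<in> carrier B" "x \<notin> Domain G"
      using Gcarr by blast
    define L where "L = {r \<in> carrier R. r \<odot>\<^bsub>B\<^esub> x \<in> Domain G}"
    define LM where "LM = (regular_module R)\<lparr>carrier := L\<rparr>"
    have Lsub: "submodule L R (regular_module R)"
      unfolding L_def by (rule submodule_annihilator) fact+
    interpret RR: left_module R "regular_module R"
      by (rule left_module_regular_module) (rule R.ring_axioms)
    note L = RR.left_submoduleE[OF Lsub, simplified]
    have LM: "left_module R LM"
      unfolding LM_def by (rule left_module_restrict[OF RR.left_module_axioms Lsub])
    define j where "j = (\<lambda>r\<in>L. r)"
    obtain I where I: "I \<in> J" "\<forall>a\<in>I. a \<odot>\<^bsub>B\<^esub> x \<in> i ` carrier A"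
      using x(1) colon by (auto simp: filter_colon_def)
    have IL: "I \<subseteq> L"
      using I(2) ideal_filterD(1)[OF J I(1)] G0 by (force simp: L_def)
    have "filter_extension R J LM (regular_module R) j"
      unfolding filter_extension_def
    proof (intro conjI LM RR.left_module_axioms)
      show "j \<in> lmod_hom R LM (regular_module R)"
        using L by (intro lmod_homI) (auto simp: LM_def j_def)
      show "inj_on j (carrier LM)" by (auto simp: LM_def j_def inj_on_def)
      have "j ` carrier LM = L" by (auto simp: LM_def j_def)
      moreover have "\<forall>r\<in>carrier R. \<forall>a\<in>I. a \<otimes>\<^bsub>R\<^esub> r \<in> L"
        using ideal_filterD(2)[OF J I(1)] IL by blast
      ultimately show "filter_colon (regular_module R) (j ` carrier LM) J = carrier (regular_module R)"
        using I(1) by (auto simp: filter_colon_def)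
    qed
    moreover
    define h where "h = (\<lambda>r\<in>L. THE p. (r \<odot>\<^bsub>B\<^esub> x, p) \<in> G)"
    have hI: "h r = p" if "r \<in> carrier R" "(r \<odot>\<^bsub>B\<^esub> x, p) \<in> G" for r p
      using that Guniq by (auto simp: h_def L_def)
    have hG: "(r \<odot>\<^bsub>B\<^esub> x, h r) \<in> G" if "r \<in> L" for r
      using that hI by (auto simp: L_def)
    have "h \<in> lmod_hom R LM Q"
    proof (rule lmod_homI)
      show "h r \<in> carrier Q" if "r \<in> carrier LM" for r
        using hG that Gcarr by (auto simp: LM_def)
      show "h r = undefined" if "r \<notin> carrier LM" for r
        using that by (simp add: h_def LM_def)
      show "h (r \<oplus>\<^bsub>LM\<^esub> s) = h r \<oplus>\<^bsub>Q\<^esub> h s" if "r \<in> carrier LM" "s \<in> carrier LM" for r s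
      proof -
        have rs: "r \<in> L" "s \<in> L" "r \<in> carrier R" "s \<in> carrier R"
          using that by (auto simp: LM_def L_def)
        then have "((r \<oplus>\<^bsub>R\<^esub> s) \<odot>\<^bsub>B\<^esub> x, h r \<oplus>\<^bsub>Q\<^esub> h s) \<in> G"
          using Gadd[OF hG hG] x(1) by (simp add: B.smult_l_distr)
        then show ?thesis using hI rs by (simp add: LM_def)
      qed
      show "h (r \<odot>\<^bsub>LM\<^esub> s) = r \<odot>\<^bsub>Q\<^esub> h s" if "r \<in> carrier R" "s \<in> carrier LM" for r s
      proof -
        have rs: "s \<in> L" "s \<in> carrier R"
          using that by (auto simp: LM_def L_def)
        then have "((r \<otimes>\<^bsub>R\<^esub> s) \<odot>\<^bsub>B\<^esub> x, r \<odot>\<^bsub>Q\<^esub> h s) \<in> G"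
          using Gsmult[OF that(1) hG] x(1) that(1) by (simp add: B.smult_assoc1)
        then show ?thesis using hI rs that(1) by (simp add: LM_def)
      qed
    qed
    ultimately obtain h' where h': "h' \<in> lmod_hom R (regular_module R) Q"
      and hh': "\<forall>r\<in>carrier LM. h' (j r) = h r"
      using inj unfolding filter_injective_def by blast
    define z where "z = h' \<one>\<^bsub>R\<^esub>"
    have z: "z \<in> carrier Q"
      using lmod_homD(1)[OF h'] by (simp add: z_def)
    have rz: "(r \<odot>\<^bsub>B\<^esub> x, r \<odot>\<^bsub>Q\<^esub> z) \<in> G" if "r \<in> L" for r
    proof -
      have "r \<in> carrier R" using that by (simp add: L_def)
      then have "r \<odot>\<^bsub>Q\<^esub> z = h' r"
        using lmod_homD(4)[OF h', of r "\<one>\<^bsub>R\<^esub>"] by (simp add: z_def)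
      also have "\<dots> = h r" using hh' that by (simp add: LM_def j_def)
      finally show ?thesis using hG[OF that] by simp
    qed
    define H where "H = {(y \<oplus>\<^bsub>B\<^esub> r \<odot>\<^bsub>B\<^esub> x, p \<oplus>\<^bsub>Q\<^esub> r \<odot>\<^bsub>Q\<^esub> z) | y p r. (y, p) \<in> G \<and> r \<in> carrier R}"
    have HI: "(u, v) \<in> H" if "(y, p) \<in> G" "r \<in> carrier R" "u = y \<oplus>\<^bsub>B\<^esub> r \<odot>\<^bsub>B\<^esub> x" "v = p \<oplus>\<^bsub>Q\<^esub> r \<odot>\<^bsub>Q\<^esub> z"
      for u v y p r
      using that by (auto simp: H_def)
    have HE: "\<exists>y p r. (y, p) \<in> G \<and> r \<in> carrier R \<and> u = y \<oplus>\<^bsub>B\<^esub> r \<odot>\<^bsub>B\<^esub> x \<and> v = p \<oplus>\<^bsub>Q\<^esub> r \<odot>\<^bsub>Q\<^esub> z"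
      if "(u, v) \<in> H" for u v
      using that by (auto simp: H_def)
    have GH: "G \<subseteq> H"
    proof (rule subrelI)
      fix y p assume "(y, p) \<in> G"
      then show "(y, p) \<in> H"
        using Gcarr x(1) z by (intro HI[of y p "\<zero>\<^bsub>R\<^esub>"]) auto
    qed
    have "H \<in> \<G>"
      unfolding \<G>_def
    proof (rule CollectI, intro conjI allI impI ballI)
      show "H \<subseteq> carrier B \<times> carrier Q"
        using Gcarr x(1) z by (auto simp: H_def)
      show "G0 \<subseteq> H" using \<G>D(2)[OF G] GH by blast
    next
      fix u v u' v' assume "(u, v) \<in> H" "(u', v') \<in> H"
      then obtain y p r y' p' r' where e: "(y, p) \<in> G" "r \<in> carrier R" "u = y \<oplus>\<^bsub>B\<^esub> r \<odot>\<^bsub>B\<^esub> x"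
        "v = p \<oplus>\<^bsub>Q\<^esub> r \<odot>\<^bsub>Q\<^esub> z" "(y', p') \<in> G" "r' \<in> carrier R" "u' = y' \<oplus>\<^bsub>B\<^esub> r' \<odot>\<^bsub>B\<^esub> x"
        "v' = p' \<oplus>\<^bsub>Q\<^esub> r' \<odot>\<^bsub>Q\<^esub> z"
        using HE by meson
      show "(u \<oplus>\<^bsub>B\<^esub> u', v \<oplus>\<^bsub>Q\<^esub> v') \<in> H"
        by (rule HI[OF Gadd[OF e(1,5)], of "r \<oplus>\<^bsub>R\<^esub> r'"])
          (use e Gcarr[OF e(1)] Gcarr[OF e(5)] x(1) z in
            \<open>simp_all add: B.smult_l_distr Q.smult_l_distr B.M.add.m_ac Q.M.add.m_ac\<close>)
    next
      fix a u v assume a: "a \<in> carrier R" and "(u, v) \<in> H"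
      then obtain y p r where e: "(y, p) \<in> G" "r \<in> carrier R" "u = y \<oplus>\<^bsub>B\<^esub> r \<odot>\<^bsub>B\<^esub> x"
        "v = p \<oplus>\<^bsub>Q\<^esub> r \<odot>\<^bsub>Q\<^esub> z"
        using HE by meson
      show "(a \<odot>\<^bsub>B\<^esub> u, a \<odot>\<^bsub>Q\<^esub> v) \<in> H"
        by (rule HI[OF Gsmult[OF a e(1)], of "a \<otimes>\<^bsub>R\<^esub> r"])
          (use a e Gcarr[OF e(1)] x(1) z in
            \<open>simp_all add: B.smult_r_distr Q.smult_r_distr B.smult_assoc1 Q.smult_assoc1\<close>)
    next
      fix u v v' assume "(u, v) \<in> H" "(u, v') \<in> H"
      then obtain y p r y' p' r' where e: "(y, p) \<in> G" "r \<in> carrier R" "u = y \<oplus>\<^bsub>B\<^esub> r \<odot>\<^bsub>B\<^esub> x"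
        "v = p \<oplus>\<^bsub>Q\<^esub> r \<odot>\<^bsub>Q\<^esub> z" "(y', p') \<in> G" "r' \<in> carrier R" "u = y' \<oplus>\<^bsub>B\<^esub> r' \<odot>\<^bsub>B\<^esub> x"
        "v' = p' \<oplus>\<^bsub>Q\<^esub> r' \<odot>\<^bsub>Q\<^esub> z"
        using HE by meson
      define s where "s = r \<oplus>\<^bsub>R\<^esub> \<ominus>\<^bsub>R\<^esub> r'"
      have s: "s \<in> carrier R" "r = s \<oplus>\<^bsub>R\<^esub> r'"
        using e by (auto simp: s_def R.a_assoc R.l_neg)
      have c: "y \<in> carrier B" "y' \<in> carrier B" "p \<in> carrier Q" "p' \<in> carrier Q"
        using Gcarr e by auto
      have "(y \<oplus>\<^bsub>B\<^esub> s \<odot>\<^bsub>B\<^esub> x) \<oplus>\<^bsub>B\<^esub> r' \<odot>\<^bsub>B\<^esub> x = y' \<oplus>\<^bsub>B\<^esub> r' \<odot>\<^bsub>B\<^esub> x"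
        using e(3,7) s e(6) c x(1) by (simp add: B.smult_l_distr B.M.a_assoc)
      then have y': "y \<oplus>\<^bsub>B\<^esub> s \<odot>\<^bsub>B\<^esub> x = y'"
        using c s e(6) x(1) by simp
      then have "s \<odot>\<^bsub>B\<^esub> x = \<ominus>\<^bsub>B\<^esub> y \<oplus>\<^bsub>B\<^esub> y'"
        using c s x(1) by (auto simp: B.M.r_neg1)
      then have "s \<in> L"
        using Gadd[OF Gminus[OF e(1)] e(5)] s(1) by (auto simp: L_def)
      then have "(y', p \<oplus>\<^bsub>Q\<^esub> s \<odot>\<^bsub>Q\<^esub> z) \<in> G"
        using Gadd[OF e(1) rz[OF \<open>s \<in> L\<close>]] y' by simp
      then have "p \<oplus>\<^bsub>Q\<^esub> s \<odot>\<^bsub>Q\<^esub> z = p'"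
        using Guniq e(5) by blast
      then show "v = v'"
        using e(4,8) s e(6) c z by (auto simp: Q.smult_l_distr Q.M.a_assoc)
    qed
    then have "H = G" using max GH by blast
    moreover have "(x, z) \<in> H"
      by (rule HI[OF Gzero, of "\<one>\<^bsub>R\<^esub>"]) (use x(1) z in auto)
    ultimately show False using x(2) by blast
  qed
  define g where "g = (\<lambda>x\<in>carrier B. THE p. (x, p) \<in> G)"
  have gI: "g x = p" if "(x, p) \<in> G" for x p
    using that Guniq Gcarr by (auto simp: g_def)
  have gG: "(x, g x) \<in> G" if "x \<in> carrier B" for x
    using that gI \<open>Domain G = carrier B\<close> by (metis DomainE)
  have "g \<in> lmod_hom R B Q"
    by (rule lmod_homI) (use Gcarr gG Gadd Gsmult gI in \<open>auto simp: g_def\<close>)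
  moreover have "\<forall>a\<in>carrier A. g (i a) = f a"
    using gI G0 by blast
  ultimately show ?thesis by blast
qed

corollary filter_injective_all_types:
  fixes R :: "('r, 'x) ring_scheme"
  assumes "ideal_filter R J" and "left_module R Q" and "filter_injective TYPE('r) R J Q"
  shows "filter_injective TYPE('b) R J Q"
  using filter_injective_extends[OF assms] unfolding filter_injective_def by blast

end

theory Submission
  imports Defs
begin

text \<open>
  The only inclusion that is not formal is \<open>Hom(M/ker V, T) \<subseteq> V\<close>. If \<open>W\<close> is a closed submodule of
  \<open>Hom(M, T)\<close>, i.e. \<open>W = Hom(M/ker W, T)\<close>, then so is \<open>W + End(T) f\<close> for every \<open>f\<close>: a homomorphism \<open>g\<close>
  vanishing on \<open>ker W \<inter> ker f\<close> agrees on \<open>ker W\<close> with \<open>e \<circ> f\<close> for some endomorphism \<open>e\<close> of \<open>T\<close>, because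
  \<open>f (ker W) \<subseteq> T\<close> is a \<open>J\<close>-extension (\<open>T\<close> is torsion) and \<open>T\<close> is \<open>J\<close>-injective; hence
  \<open>g - e \<circ> f \<in> W\<close>. As \<open>0\<close> is closed and \<open>Hom(M, T)\<close> is Noetherian, there is a maximal closed \<open>W \<subseteq> V\<close>, and by
  the previous step it contains every \<open>f \<in> V\<close>.
\<close>

section \<open>Chain condition and cyclic enlargement of submodules\<close>

text \<open>Noetherianity is phrased with sequences. If every member of \<open>S\<close> had a
  strictly larger one in \<open>S\<close>, dependent choice would build a strictly increasing
  sequence, which cannot stabilise.\<close>

lemma noetherian_module_maximal:
  assumes noeth: "noetherian_module R M" and "S \<noteq> {}" and sub: "\<And>N. N \<in> S \<Longrightarrow> submodule N R M"
  obtains N where "N \<in> S" and "\<And>N'. \<lbrakk>N' \<in> S; N \<subseteq> N'\<rbrakk> \<Longrightarrow> N' = N"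
proof (rule ccontr)
  assume "\<not> thesis"
  then have step: "\<exists>N'. N' \<in> S \<and> N \<subset> N'" if "N \<in> S" for N
    using that \<open>\<And>N. \<lbrakk>N \<in> S; \<And>N'. \<lbrakk>N' \<in> S; N \<subseteq> N'\<rbrakk> \<Longrightarrow> N' = N\<rbrakk> \<Longrightarrow> thesis\<close> by blast
  have "\<exists>F. \<forall>n. F n \<in> S \<and> F n \<subset> F (Suc n)"
    using \<open>S \<noteq> {}\<close> step by (intro dependent_nat_choice) auto
  then obtain F where F: "\<And>n. F n \<in> S" "\<And>n. F n \<subset> F (Suc n)"
    by blast
  then have "(\<forall>n. submodule (F n) R M) \<and> (\<forall>n. F n \<subseteq> F (Suc n))"
    using sub by blast
  then obtain n where "\<forall>m\<ge>n. F m = F n"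
    using noeth unfolding noetherian_module_def by blast
  then have "F (Suc n) = F n"
    by (metis le_SucI order_refl)
  then show False
    using F(2)[of n] by simp
qed

text \<open>Meant for the module \<open>Hom(M, T)\<close> over \<open>End(T)\<close>, where it
  enlarges a closed submodule \<open>W\<close> to \<open>W + End(T) f\<close>. The explicit form of
  the elements is what later allows membership to be read off from an equation.\<close>

lemma (in left_module) submodule_add_cyclic:
  assumes "submodule N R M" and x: "x \<in> carrier M"
  defines "H \<equiv> {n \<oplus>\<^bsub>M\<^esub> a \<odot>\<^bsub>M\<^esub> x | n a. n \<in> N \<and> a \<in> carrier R}"
  shows "submodule H R M" and "N \<subseteq> H" and "x \<in> H"
proof -
  note N = left_submoduleE[OF assms(1)]
  note C = subsetD[OF N(1)]
  have HI: "u \<in> H" if "n \<in> N" "a \<in> carrier R" "u = n \<oplus>\<^bsub>M\<^esub> a \<odot>\<^bsub>M\<^esub> x" for u n a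
    using that by (auto simp: H_def)
  show "N \<subseteq> H"
    using C x by (auto intro!: HI[of _ \<zero>])
  show "x \<in> H"
    using x N(2) by (auto intro!: HI[of "\<zero>\<^bsub>M\<^esub>" \<one>])
  show "submodule H R M"
  proof (rule left_submoduleI)
    show "H \<subseteq> carrier M"
      using C x by (auto simp: H_def)
    show "\<zero>\<^bsub>M\<^esub> \<in> H"
      using \<open>N \<subseteq> H\<close> N(2) by blast
  next
    fix u v assume "u \<in> H" "v \<in> H"
    then obtain n a m b where e: "n \<in> N" "a \<in> carrier R" "u = n \<oplus>\<^bsub>M\<^esub> a \<odot>\<^bsub>M\<^esub> x"
      "m \<in> N" "b \<in> carrier R" "v = m \<oplus>\<^bsub>M\<^esub> b \<odot>\<^bsub>M\<^esub> x"
      by (auto simp: H_def)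
    show "u \<oplus>\<^bsub>M\<^esub> v \<in> H"
      by (rule HI[of "n \<oplus>\<^bsub>M\<^esub> m" "a \<oplus> b"]) (use e C x N(3) in \<open>auto simp: smult_l_distr M.add.m_ac\<close>)
  next
    fix r u assume r: "r \<in> carrier R" and "u \<in> H"
    then obtain n a where e: "n \<in> N" "a \<in> carrier R" "u = n \<oplus>\<^bsub>M\<^esub> a \<odot>\<^bsub>M\<^esub> x"
      by (auto simp: H_def)
    show "r \<odot>\<^bsub>M\<^esub> u \<in> H"
      by (rule HI[of "r \<odot>\<^bsub>M\<^esub> n" "r \<otimes> a"]) (use e r C x N(4) in \<open>auto simp: smult_r_distr smult_assoc1\<close>)
  qed
qed

section \<open>The two maps \<open>hom_ker\<close> and \<open>quot_hom\<close>\<close>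

lemma hom_ker_iff: "x \<in> hom_ker M T V \<longleftrightarrow> x \<in> carrier M \<and> (\<forall>f\<in>V. f x = \<zero>\<^bsub>T\<^esub>)"
  by (auto simp: hom_ker_def a_kernel_def')

lemma quot_hom_iff:
  "f \<in> quot_hom R M T N \<longleftrightarrow> f \<in> lmod_hom R M T \<and> (\<forall>x\<in>N. x \<in> carrier M \<and> f x = \<zero>\<^bsub>T\<^esub>)"
  by (auto simp: quot_hom_def a_kernel_def')

lemma hom_ker_antimono: "V1 \<subseteq> V2 \<Longrightarrow> hom_ker M T V2 \<subseteq> hom_ker M T V1"
  unfolding hom_ker_def by blast

lemma quot_hom_antimono: "M1 \<subseteq> M2 \<Longrightarrow> quot_hom R M T M2 \<subseteq> quot_hom R M T M1"
  unfolding quot_hom_def by blast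

lemma submodule_hom_ker:
  assumes M: "left_module R M" and T: "left_module R T" and V: "V \<subseteq> lmod_hom R M T"
  shows "submodule (hom_ker M T V) R M"
proof -
  interpret M: left_module R M by fact
  interpret T: left_module R T by fact
  note V' = subsetD[OF V]
  show ?thesis
  proof (rule M.left_submoduleI)
    show "x \<oplus>\<^bsub>M\<^esub> y \<in> hom_ker M T V" if "x \<in> hom_ker M T V" "y \<in> hom_ker M T V" for x y
    proof -
      have "f (x \<oplus>\<^bsub>M\<^esub> y) = \<zero>\<^bsub>T\<^esub>" if f: "f \<in> V" for f
      proof -
        have "f x = \<zero>\<^bsub>T\<^esub>" "f y = \<zero>\<^bsub>T\<^esub>"
          using \<open>x \<in> _\<close> \<open>y \<in> _\<close> f by (simp_all only: hom_ker_iff)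
        then show ?thesis
          using \<open>x \<in> _\<close> \<open>y \<in> _\<close> lmod_homD(3)[OF V'[OF f]] by (simp add: hom_ker_iff)
      qed
      then show ?thesis
        using that by (simp add: hom_ker_iff)
    qed
  qed (auto simp: hom_ker_iff lmod_hom_zero[OF M T V'] lmod_homD(4)[OF V'])
qed

lemma submodule_quot_hom:
  assumes M: "left_module R M" and T: "left_module R T" and N: "N \<subseteq> carrier M"
  shows "submodule (quot_hom R M T N) (End_ring R T) (Hom_module R M T)"
proof -
  interpret M: left_module R M by fact
  interpret T: left_module R T by fact
  interpret H: left_module "End_ring R T" "Hom_module R M T"
    by (rule left_module_Hom_module[OF M T])
  show ?thesis
  proof (rule H.left_submoduleI)
    show "quot_hom R M T N \<subseteq> carrier (Hom_module R M T)"
      by (auto simp: quot_hom_iff Hom_module_def)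
    show "\<zero>\<^bsub>Hom_module R M T\<^esub> \<in> quot_hom R M T N"
      using N lmod_hom_zero_fun[OF M T] by (auto simp: quot_hom_iff Hom_module_def)
    show "f \<oplus>\<^bsub>Hom_module R M T\<^esub> g \<in> quot_hom R M T N"
      if "f \<in> quot_hom R M T N" "g \<in> quot_hom R M T N" for f g
      using that lmod_hom_add[OF M T, of f g] by (auto simp: quot_hom_iff Hom_module_def)
    show "e \<odot>\<^bsub>Hom_module R M T\<^esub> f \<in> quot_hom R M T N"
      if "e \<in> carrier (End_ring R T)" "f \<in> quot_hom R M T N" for e f
      using that lmod_hom_compose[OF M, of f T e T] lmod_hom_zero[OF T T, of e]
      by (auto simp: quot_hom_iff Hom_module_def End_ring_def compose_eq)
  qed
qed

text \<open>The cogenerator property separates every nonzero coset of \<open>M/N\<close> from zero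
  by a map \<open>M/N -> T\<close>. Such maps live on cosets, while \<open>quot_hom\<close> consists
  of maps on \<open>M\<close>; \<open>bij_betw_quot_hom\<close> translates between the two.\<close>

lemma hom_ker_quot_hom:
  assumes M: "left_module R M" and T: "left_module R T" and N: "submodule N R M"
    and cog: "cogenerator_for R T (quot_module M N)"
  shows "hom_ker M T (quot_hom R M T N) = N"
proof (intro equalityI subsetI)
  interpret M: left_module R M by fact
  show "x \<in> hom_ker M T (quot_hom R M T N)" if "x \<in> N" for x
    using that M.left_submoduleE(1)[OF N] by (auto simp: hom_ker_iff quot_hom_iff)
  fix x assume x: "x \<in> hom_ker M T (quot_hom R M T N)"
  then have xM: "x \<in> carrier M"
    by (simp add: hom_ker_iff)
  note q = quot_module_simps[OF M N]
  have "\<phi> (N +>\<^bsub>M\<^esub> x) = \<zero>\<^bsub>T\<^esub>" if "\<phi> \<in> lmod_hom R (quot_module M N) T" for \<phi>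
  proof -
    have "(\<lambda>x\<in>carrier M. \<phi> (N +>\<^bsub>M\<^esub> x)) \<in> quot_hom R M T N"
      using bij_betw_apply[OF bij_betw_quot_hom[OF M N T] that] .
    then show ?thesis
      using x xM by (fastforce simp: hom_ker_iff)
  qed
  then have "N +>\<^bsub>M\<^esub> x \<in> hom_ker (quot_module M N) T (lmod_hom R (quot_module M N) T)"
    using xM by (auto simp: hom_ker_iff q)
  then have "N +>\<^bsub>M\<^esub> x = N +>\<^bsub>M\<^esub> \<zero>\<^bsub>M\<^esub>"
    using cog by (simp add: cogenerator_for_def q(3))
  then show "x \<in> N"
    using xM by (simp add: M.coset_eq_iff[OF N] M.M.add.inv_one[folded a_inv_def])
qed

section \<open>Factoring one homomorphism into \<open>T\<close> through another\<close>

text \<open>The difference \<open>d\<close> of \<open>x\<close> and \<open>y\<close> lies in the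
  kernel of \<open>f\<close>, hence in that of \<open>g\<close>. This makes the assignment sending
  \<open>f x\<close> to \<open>g x\<close> well defined on the image of \<open>f\<close>.\<close>

lemma lmod_hom_eq_imp_eq:
  assumes M: "left_module R M" and N: "left_module R N" and P: "left_module R P"
    and f: "f \<in> lmod_hom R M N" and g: "g \<in> lmod_hom R M P"
    and ker: "a_kernel M N f \<subseteq> a_kernel M P g"
    and xy: "x \<in> carrier M" "y \<in> carrier M" "f x = f y"
  shows "g x = g y"
proof -
  interpret M: left_module R M by fact
  interpret N: left_module R N by fact
  interpret P: left_module R P by fact
  define d where "d = x \<oplus>\<^bsub>M\<^esub> \<ominus>\<^bsub>M\<^esub> y"
  have d: "d \<in> carrier M" "x = d \<oplus>\<^bsub>M\<^esub> y"
    using xy by (auto simp: d_def M.M.a_assoc M.M.l_neg)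
  have "f d \<oplus>\<^bsub>N\<^esub> f y = f y"
    using lmod_homD(3)[OF f d(1) xy(2)] d(2) xy(3) by simp
  then have "f d = \<zero>\<^bsub>N\<^esub>"
    using lmod_homD(1)[OF f] d(1) xy(2) by simp
  then have "g d = \<zero>\<^bsub>P\<^esub>"
    using ker d(1) by (auto simp: a_kernel_def')
  then show ?thesis
    using lmod_homD(3)[OF g d(1) xy(2)] lmod_homD(1)[OF g xy(2)] d(2) by simp
qed

text \<open>The kernel inclusion yields a map \<open>h\<close> from the image \<open>I\<close> of
  \<open>f\<close> to \<open>T\<close> with \<open>h (f x) = g x\<close>, and \<open>e\<close> is an
  extension of \<open>h\<close> to \<open>T\<close>. It exists because \<open>T\<close> is a
  \<open>J\<close>-extension of \<open>I\<close>: each element of \<open>T\<close> is killed by some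
  \<open>L\<close> in \<open>J\<close>, so \<open>L\<close> sends it into \<open>I\<close>.\<close>

lemma filter_injective_factor:
  fixes R :: "('r, 'x) ring_scheme" and T :: "('r, 't) module" and K :: "('r, 'k) module"
  assumes J: "ideal_filter R J" and T: "left_module R T" and inj: "filter_injective TYPE('r) R J T"
    and tors: "filter_torsion J T" and K: "left_module R K"
    and f: "f \<in> lmod_hom R K T" and g: "g \<in> lmod_hom R K T"
    and ker: "a_kernel K T f \<subseteq> a_kernel K T g"
  obtains e where "e \<in> lmod_hom R T T" and "\<And>x. x \<in> carrier K \<Longrightarrow> e (f x) = g x"
proof -
  interpret K: left_module R K by fact
  interpret T: left_module R T by fact
  define I where "I = f ` carrier K"
  have I: "submodule I R T"
  proof (rule T.left_submoduleI)
    show "I \<subseteq> carrier T"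
      using lmod_homD(1)[OF f] by (auto simp: I_def)
    show "\<zero>\<^bsub>T\<^esub> \<in> I"
      using lmod_hom_zero[OF K T f] unfolding I_def by (metis K.M.zero_closed image_eqI)
    show "a \<oplus>\<^bsub>T\<^esub> b \<in> I" if "a \<in> I" "b \<in> I" for a b
      using that lmod_homD(3)[OF f, symmetric] by (auto simp: I_def)
    show "r \<odot>\<^bsub>T\<^esub> a \<in> I" if "r \<in> carrier R" "a \<in> I" for r a
      using that lmod_homD(4)[OF f, symmetric] by (auto simp: I_def)
  qed
  note I' = T.left_submoduleE[OF I]
  define A where "A = T\<lparr>carrier := I\<rparr>"
  have A: "left_module R A"
    unfolding A_def by (rule left_module_restrict[OF T I])
  have "filter_extension R J A T (\<lambda>t\<in>I. t)"
    unfolding filter_extension_def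
  proof (intro conjI A T)
    show "(\<lambda>t\<in>I. t) \<in> lmod_hom R A T"
      using I' by (intro lmod_homI) (auto simp: A_def)
    show "inj_on (\<lambda>t\<in>I. t) (carrier A)"
      by (auto simp: A_def inj_on_def)
    have "(\<lambda>t\<in>I. t) ` carrier A = I"
      by (auto simp: A_def)
    moreover have "x \<in> filter_colon T I J" if "x \<in> carrier T" for x
    proof -
      have "x \<in> filter_colon T {\<zero>\<^bsub>T\<^esub>} J"
        using tors that by (simp add: filter_torsion_def)
      then obtain L where "L \<in> J" "\<forall>a\<in>L. a \<odot>\<^bsub>T\<^esub> x = \<zero>\<^bsub>T\<^esub>"
        by (auto simp: filter_colon_def)
      then show ?thesis
        using I'(2) that by (force simp: filter_colon_def)
    qed
    moreover have "filter_colon T I J \<subseteq> carrier T"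
      by (auto simp: filter_colon_def)
    ultimately show "filter_colon T ((\<lambda>t\<in>I. t) ` carrier A) J = carrier T"
      by auto
  qed
  moreover
  \<comment> \<open>An arbitrary preimage is chosen; \<open>hf\<close> shows that the value does not
    depend on it.\<close>
  define h where "h = (\<lambda>t\<in>I. g (inv_into (carrier K) f t))"
  have hf: "h (f x) = g x" if x: "x \<in> carrier K" for x
  proof -
    have fx: "f x \<in> f ` carrier K" using x by simp
    show ?thesis
      using lmod_hom_eq_imp_eq[OF K T T f g ker inv_into_into[OF fx] x f_inv_into_f[OF fx]] fx
      by (simp add: h_def I_def)
  qed
  have "h \<in> lmod_hom R A T"
  proof (rule lmod_homI)
    show "h t \<in> carrier T" if "t \<in> carrier A" for t
      using that hf lmod_homD(1)[OF g] by (auto simp: A_def I_def)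
    show "h t = undefined" if "t \<notin> carrier A" for t
      using that by (simp add: A_def h_def)
    show "h (s \<oplus>\<^bsub>A\<^esub> t) = h s \<oplus>\<^bsub>T\<^esub> h t" if "s \<in> carrier A" "t \<in> carrier A" for s t
      using that by (auto simp: A_def I_def hf lmod_homD(3)[OF f, symmetric] lmod_homD(3)[OF g])
    show "h (r \<odot>\<^bsub>A\<^esub> t) = r \<odot>\<^bsub>T\<^esub> h t" if "r \<in> carrier R" "t \<in> carrier A" for r t
      using that by (auto simp: A_def I_def hf lmod_homD(4)[OF f, symmetric] lmod_homD(4)[OF g])
  qed
  \<comment> \<open>Injectivity is assumed for modules with elements of type \<open>'r\<close>,
    whereas \<open>A\<close> and \<open>T\<close> have elements of type \<open>'t\<close>. The
    Baer-type lemma \<open>filter_injective_extends\<close> bridges this gap.\<close>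
  ultimately obtain e where "e \<in> lmod_hom R T T" "\<forall>a\<in>carrier A. e ((\<lambda>t\<in>I. t) a) = h a"
    using filter_injective_extends[OF J T inj] by blast
  then show thesis
    using hf by (intro that[of e]) (auto simp: A_def I_def)
qed

section \<open>Closed submodules of \<open>Hom(M, T)\<close>\<close>

lemma quot_hom_hom_ker_add_cyclic:
  fixes R :: "('r, 'x) ring_scheme" and T :: "('r, 't) module" and M :: "('r, 'm) module"
  assumes J: "ideal_filter R J" and T: "left_module R T" and inj: "filter_injective TYPE('r) R J T"
    and tors: "filter_torsion J T" and M: "left_module R M"
    and W: "W \<subseteq> lmod_hom R M T" and closed: "quot_hom R M T (hom_ker M T W) = W"
    and f: "f \<in> lmod_hom R M T" and g: "g \<in> quot_hom R M T (hom_ker M T (insert f W))"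
  shows "\<exists>w\<in>W. \<exists>e\<in>carrier (End_ring R T).
           g = w \<oplus>\<^bsub>Hom_module R M T\<^esub> e \<odot>\<^bsub>Hom_module R M T\<^esub> f"
proof -
  interpret M: left_module R M by fact
  interpret T: left_module R T by fact
  define K where "K = hom_ker M T W"
  define KM where "KM = M\<lparr>carrier := K\<rparr>"
  have K: "submodule K R M"
    unfolding K_def by (rule submodule_hom_ker[OF M T W])
  note K' = M.left_submoduleE[OF K]
  have KM: "left_module R KM"
    unfolding KM_def by (rule left_module_restrict[OF M K])
  have gM: "g \<in> lmod_hom R M T" and g0: "\<And>x. \<lbrakk>x \<in> K; f x = \<zero>\<^bsub>T\<^esub>\<rbrakk> \<Longrightarrow> g x = \<zero>\<^bsub>T\<^esub>"
    using g by (auto simp: quot_hom_iff hom_ker_iff K_def)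
  \<comment> \<open>Homomorphisms are extensional, so maps on \<open>M\<close> must be restricted
    explicitly to become maps on \<open>KM\<close>.\<close>
  have restr: "restrict u K \<in> lmod_hom R KM T" if u: "u \<in> lmod_hom R M T" for u
    using K' by (intro lmod_homI) (auto simp: KM_def subset_iff lmod_homD[OF u])
  \<comment> \<open>The kernel of \<open>f\<close> on \<open>K\<close> is the common kernel of
    \<open>insert f W\<close>, where \<open>g\<close> vanishes by assumption.\<close>
  have "a_kernel KM T (restrict f K) \<subseteq> a_kernel KM T (restrict g K)"
    using g0 by (auto simp: a_kernel_def' KM_def)
  then obtain e where e: "e \<in> lmod_hom R T T"
    and "\<And>x. x \<in> carrier KM \<Longrightarrow> e (restrict f K x) = restrict g K x"
    using filter_injective_factor[OF J T inj tors KM restr[OF f] restr[OF gM]] by blast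
  then have ef: "e (f x) = g x" if "x \<in> K" for x
    using that by (force simp: KM_def)
  define u where "u = compose (carrier M) e f"
  \<comment> \<open>This is \<open>g - e \<circ> f\<close>. It vanishes on \<open>K\<close>, where
    \<open>e \<circ> f\<close> agrees with \<open>g\<close>, so closedness of \<open>W\<close> puts
    it into \<open>W\<close>. The inner abstraction has the shape produced by
    \<open>lmod_hom_uminus\<close>.\<close>
  define w where "w = (\<lambda>x\<in>carrier M. g x \<oplus>\<^bsub>T\<^esub> (\<lambda>x\<in>carrier M. \<ominus>\<^bsub>T\<^esub> u x) x)"
  have u: "u \<in> lmod_hom R M T"
    unfolding u_def by (rule lmod_hom_compose[OF M f e])
  have "w \<in> lmod_hom R M T"
    unfolding w_def by (rule lmod_hom_add[OF M T gM lmod_hom_uminus[OF M T u]])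
  moreover have "w x = \<zero>\<^bsub>T\<^esub>" if "x \<in> K" for x
    using that K'(1) ef lmod_homD(1)[OF gM] by (auto simp: w_def u_def compose_eq T.M.r_neg)
  ultimately have "w \<in> quot_hom R M T K"
    using K'(1) by (auto simp: quot_hom_iff)
  then have "w \<in> W"
    using closed by (simp add: K_def)
  moreover have "g = (\<lambda>x\<in>carrier M. w x \<oplus>\<^bsub>T\<^esub> u x)"
  proof (rule extensionalityI[OF lmod_homD(2)[OF gM]])
    fix x assume "x \<in> carrier M"
    then show "g x = (\<lambda>x\<in>carrier M. w x \<oplus>\<^bsub>T\<^esub> u x) x"
      using lmod_homD(1)[OF gM] lmod_homD(1)[OF u] by (simp add: w_def T.M.a_assoc T.M.l_neg)
  qed simp
  ultimately show ?thesis
    using e by (auto simp: Hom_module_def End_ring_def u_def)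
qed

lemma quot_hom_hom_ker:
  fixes R :: "('r, 'x) ring_scheme" and T :: "('r, 't) module" and M :: "('r, 'm) module"
  assumes J: "ideal_filter R J" and T: "left_module R T" and inj: "filter_injective TYPE('r) R J T"
    and tors: "filter_torsion J T" and M: "left_module R M"
    and noeth: "noetherian_module (End_ring R T) (Hom_module R M T)"
    and V: "submodule V (End_ring R T) (Hom_module R M T)"
  shows "quot_hom R M T (hom_ker M T V) = V"
proof -
  interpret M: left_module R M by fact
  interpret H: left_module "End_ring R T" "Hom_module R M T"
    by (rule left_module_Hom_module[OF M T])
  interpret T: left_module R T by fact
  have carrier_H: "carrier (Hom_module R M T) = lmod_hom R M T"
    by (simp add: Hom_module_def)
  note VE = H.left_submoduleE[OF V, unfolded carrier_H]
  have incl: "W \<subseteq> quot_hom R M T (hom_ker M T W)" if "W \<subseteq> lmod_hom R M T" for W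
    using that by (auto simp: quot_hom_iff hom_ker_iff)
  \<comment> \<open>Maximality is sought among the closed submodules of \<open>V\<close> only, since
    closedness of \<open>V\<close> itself is the goal.\<close>
  define S where "S = {W. submodule W (End_ring R T) (Hom_module R M T) \<and> W \<subseteq> V \<and>
    quot_hom R M T (hom_ker M T W) = W}"
  \<comment> \<open>This is the zero submodule, written as \<open>Hom(M/M, T)\<close>: its kernel is
    all of \<open>M\<close>, so closedness holds by definition.\<close>
  define Z where "Z = quot_hom R M T (carrier M)"
  have "Z \<in> S"
  proof -
    have Z0: "f = \<zero>\<^bsub>Hom_module R M T\<^esub>" if "f \<in> Z" for f
      using that lmod_homD(2)[of f R M T]
      by (auto simp: Z_def quot_hom_iff Hom_module_def fun_eq_iff extensional_def)
    have "hom_ker M T Z = carrier M"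
      by (auto simp: Z_def hom_ker_iff quot_hom_iff)
    then show ?thesis
      using submodule_quot_hom[OF M T subset_refl] Z0 VE(2) by (auto simp: S_def Z_def)
  qed
  then have "S \<noteq> {}" by blast
  moreover have "submodule W (End_ring R T) (Hom_module R M T)" if "W \<in> S" for W
    using that by (simp add: S_def)
  ultimately obtain W where W: "W \<in> S" and max: "\<And>W'. \<lbrakk>W' \<in> S; W \<subseteq> W'\<rbrakk> \<Longrightarrow> W' = W"
    using noetherian_module_maximal[OF noeth] by metis
  have sub: "submodule W (End_ring R T) (Hom_module R M T)" and WV: "W \<subseteq> V"
    and closed: "quot_hom R M T (hom_ker M T W) = W"
    using W by (auto simp: S_def)
  have "f \<in> W" if fV: "f \<in> V" for f
  proof -
    have f: "f \<in> lmod_hom R M T"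
      using fV VE(1) by blast
    define W' where "W' = {w \<oplus>\<^bsub>Hom_module R M T\<^esub> e \<odot>\<^bsub>Hom_module R M T\<^esub> f | w e.
      w \<in> W \<and> e \<in> carrier (End_ring R T)}"
    have W': "submodule W' (End_ring R T) (Hom_module R M T)" "W \<subseteq> W'" "f \<in> W'"
      unfolding W'_def using H.submodule_add_cyclic[OF sub] f by (auto simp only: carrier_H)
    \<comment> \<open>An element of \<open>W'\<close> has the form \<open>w + e \<circ> f\<close>,
      and \<open>e\<close> fixes zero, so it vanishes wherever \<open>f\<close> and all of
      \<open>W\<close> do. As \<open>quot_hom\<close> reverses inclusions, the previous lemma then
      applies to every \<open>g\<close> vanishing on the kernel of \<open>W'\<close>.\<close>
    have ker: "hom_ker M T (insert f W) \<subseteq> hom_ker M T W'"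
    proof
      fix x assume x: "x \<in> hom_ker M T (insert f W)"
      then have xM: "x \<in> carrier M" and fx: "f x = \<zero>\<^bsub>T\<^esub>"
        by (simp_all only: hom_ker_iff) blast+
      have "w x \<oplus>\<^bsub>T\<^esub> e (f x) = \<zero>\<^bsub>T\<^esub>" if "w \<in> W" "e \<in> lmod_hom R T T" for w e
      proof -
        have "w x = \<zero>\<^bsub>T\<^esub>"
          using x \<open>w \<in> W\<close> by (simp only: hom_ker_iff) blast
        then show ?thesis
          using fx lmod_hom_zero[OF T T that(2)] by simp
      qed
      then show "x \<in> hom_ker M T W'"
        using xM by (auto simp: hom_ker_iff W'_def Hom_module_def End_ring_def compose_eq)
    qed
    have "W' \<subseteq> V"
      using WV VE(3,4) fV by (auto simp: W'_def)
    moreover have "quot_hom R M T (hom_ker M T W') \<subseteq> W'"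
    proof
      fix g assume "g \<in> quot_hom R M T (hom_ker M T W')"
      then have "g \<in> quot_hom R M T (hom_ker M T (insert f W))"
        using quot_hom_antimono[OF ker] by blast
      then show "g \<in> W'"
        using quot_hom_hom_ker_add_cyclic[OF J T inj tors M subset_trans[OF WV VE(1)] closed f]
        unfolding W'_def by blast
    qed
    ultimately have "W' \<in> S"
      using W'(1) incl[of W'] VE(1) by (auto simp: S_def)
    then show ?thesis
      using max W'(2,3) by blast
  qed
  then have "V = W"
    using WV by blast
  then show ?thesis
    using closed by simp
qed

section \<open>The mutually inverse bijections\<close>

theorem theorem2p35:
  fixes R :: "('r, 'x) ring_scheme" and J :: "'r set set"
    and T :: "('r, 't) module" and M :: "('r, 'm) module"
  assumes "ring R" and "ideal_filter R J" and "complete_filter TYPE('r) R J"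
    and "left_module R T" and "filter_injective TYPE('r) R J T" and "filter_torsion J T"
    and "left_module R M"
    and "\<forall>N. submodule N R M \<longrightarrow> cogenerator_for R T (quot_module M N)"
    and "noetherian_module (End_ring R T) (Hom_module R M T)"
  shows
    "bij_betw (quot_hom R M T)
       {M'. submodule M' R M} {V. submodule V (End_ring R T) (Hom_module R M T)} \<and>
     bij_betw (hom_ker M T)
       {V. submodule V (End_ring R T) (Hom_module R M T)} {M'. submodule M' R M} \<and>
     (\<forall>M'. submodule M' R M \<longrightarrow> hom_ker M T (quot_hom R M T M') = M') \<and>
     (\<forall>V. submodule V (End_ring R T) (Hom_module R M T) \<longrightarrow>
        quot_hom R M T (hom_ker M T V) = V) \<and>
     (\<forall>M1 M2. submodule M1 R M \<and> submodule M2 R M \<and> M1 \<subseteq> M2 \<longrightarrow>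
        quot_hom R M T M2 \<subseteq> quot_hom R M T M1) \<and>
     (\<forall>V1 V2. submodule V1 (End_ring R T) (Hom_module R M T) \<and>
        submodule V2 (End_ring R T) (Hom_module R M T) \<and> V1 \<subseteq> V2 \<longrightarrow>
        hom_ker M T V2 \<subseteq> hom_ker M T V1)"
proof -
  let ?SM = "{M'. submodule M' R M}"
  let ?SV = "{V. submodule V (End_ring R T) (Hom_module R M T)}"
  interpret M: left_module R M by fact
  interpret H: left_module "End_ring R T" "Hom_module R M T"
    by (rule left_module_Hom_module) fact+
  \<comment> \<open>This composite rests on the cogenerator assumption; the next one rests on
    injectivity, torsion and the chain condition.\<close>
  have ker_quot: "hom_ker M T (quot_hom R M T M') = M'" if "M' \<in> ?SM" for M'
    using that assms by (intro hom_ker_quot_hom) auto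
  have quot_ker: "quot_hom R M T (hom_ker M T V) = V" if "V \<in> ?SV" for V
    using that quot_hom_hom_ker[OF assms(2,4,5,6,7,9)] by simp
  have quot: "quot_hom R M T ` ?SM \<subseteq> ?SV"
    using submodule_quot_hom[OF assms(7,4)] M.left_submoduleE(1) by blast
  have "V \<subseteq> lmod_hom R M T" if "V \<in> ?SV" for V
    using that H.left_submoduleE(1) by (force simp: Hom_module_def)
  then have ker: "hom_ker M T ` ?SV \<subseteq> ?SM"
    using submodule_hom_ker[OF assms(7,4)] by blast
  have "bij_betw (quot_hom R M T) ?SM ?SV"
    by (rule bij_betw_byWitness[where f' = "hom_ker M T"]) (use ker_quot quot_ker quot ker in blast)+
  moreover have "bij_betw (hom_ker M T) ?SV ?SM"
    by (rule bij_betw_byWitness[where f' = "quot_hom R M T"]) (use ker_quot quot_ker quot ker in blast)+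
  ultimately show ?thesis
    using ker_quot quot_ker by (simp add: hom_ker_antimono quot_hom_antimono)
qed

end
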